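(* The identity function $f\colon S^1\to S^1$ is not quantum nullhomotopic as a loop in $S^1$.
   Context: $S^1$ is the unit circle, $D^2$ is the unit disk, and $j\colon S^1\hookrightarrow D^2$ is the inclusion map. For a compact Hausdorff space $X$, $C(X)$ is the C*-algebra of continuous complex-valued functions on $X$, and for a continuous map $g\colon X \to Y$, $g^\star\colon C(Y)\to C(X)$ is $a\mapsto a\circ g$. A loop in a compact Hausdorff space $T$ is a continuous function $f\colon S^1\to T$. A loop $f$ in $T$ is quantum nullhomotopic if there is a nonzero finite-dimensional (complex) Hilbert space $H$ and a unital $*$-homomorphism $\phi\colon C(T)\to C(D^2)\otimes L(H)$ such that $(j^\star\otimes\mathrm{id})(\phi(a)) = f^\star(a)\otimes 1_H$ for all $a\in C(T)$, where $L(H)$ is the C*-algebra of linear operators on $H$ and $\otimes$ is the tensor product of C*-algebras. *)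

theory Defs
  imports "HOL-Analysis.Analysis" "HOL-Algebra.Module"
begin

section \<open>Unital C*-algebras\<close>

definition complex_ring :: "complex ring" where
  "complex_ring = \<lparr>carrier = UNIV, mult = (*), one = 1, zero = 0, add = (+)\<rparr>"

record 'a cstar = "(complex, 'a) module" +
  star :: "'a \<Rightarrow> 'a"
  cnorm :: "'a \<Rightarrow> real"

locale unital_cstar_algebra =
  fixes A :: "('a, 'm) cstar_scheme" (structure)
  assumes module: "module complex_ring A"
    and ring: "ring A"
    and smult_mult_left:
      "\<lbrakk>x \<in> carrier A; y \<in> carrier A\<rbrakk> \<Longrightarrow> (c \<odot> x) \<otimes> y = c \<odot> (x \<otimes> y)"
    and smult_mult_right:
      "\<lbrakk>x \<in> carrier A; y \<in> carrier A\<rbrakk> \<Longrightarrow> x \<otimes> (c \<odot> y) = c \<odot> (x \<otimes> y)"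
    and star_closed: "x \<in> carrier A \<Longrightarrow> star A x \<in> carrier A"
    and star_star: "x \<in> carrier A \<Longrightarrow> star A (star A x) = x"
    and star_add:
      "\<lbrakk>x \<in> carrier A; y \<in> carrier A\<rbrakk> \<Longrightarrow> star A (x \<oplus> y) = star A x \<oplus> star A y"
    and star_smult: "x \<in> carrier A \<Longrightarrow> star A (c \<odot> x) = cnj c \<odot> star A x"
    and star_mult:
      "\<lbrakk>x \<in> carrier A; y \<in> carrier A\<rbrakk> \<Longrightarrow> star A (x \<otimes> y) = star A y \<otimes> star A x"
    and cnorm_eq_0: "x \<in> carrier A \<Longrightarrow> cnorm A x = 0 \<longleftrightarrow> x = \<zero>"
    and cnorm_smult: "x \<in> carrier A \<Longrightarrow> cnorm A (c \<odot> x) = cmod c * cnorm A x"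
    and cnorm_add:
      "\<lbrakk>x \<in> carrier A; y \<in> carrier A\<rbrakk> \<Longrightarrow> cnorm A (x \<oplus> y) \<le> cnorm A x + cnorm A y"
    and cnorm_mult:
      "\<lbrakk>x \<in> carrier A; y \<in> carrier A\<rbrakk> \<Longrightarrow> cnorm A (x \<otimes> y) \<le> cnorm A x * cnorm A y"
    and cnorm_star_mult: "x \<in> carrier A \<Longrightarrow> cnorm A (star A x \<otimes> x) = (cnorm A x)\<^sup>2"
    and complete:
      "\<lbrakk>\<And>n. s n \<in> carrier A; \<And>e. e > 0 \<Longrightarrow> \<exists>N. \<forall>m\<ge>N. \<forall>n\<ge>N. cnorm A (s m \<ominus> s n) < e\<rbrakk>
        \<Longrightarrow> \<exists>l \<in> carrier A. (\<lambda>n. cnorm A (s n \<ominus> l)) \<longlonglongrightarrow> 0"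

text \<open>\<^const>\<open>ring_hom\<close> includes preservation of the unit.\<close>

definition unital_star_hom ::
    "('a, 'm) cstar_scheme \<Rightarrow> ('b, 'n) cstar_scheme \<Rightarrow> ('a \<Rightarrow> 'b) set" where
  "unital_star_hom A B =
    {\<phi> \<in> ring_hom A B.
      (\<forall>c. \<forall>a \<in> carrier A. \<phi> (c \<odot>\<^bsub>A\<^esub> a) = c \<odot>\<^bsub>B\<^esub> \<phi> a) \<and>
      (\<forall>a \<in> carrier A. \<phi> (star A a) = star B (\<phi> a))}"


section \<open>Algebras of functions\<close>

definition complex_cstar :: "complex cstar" where
  "complex_cstar = \<lparr>carrier = UNIV, mult = (*), one = 1, zero = 0, add = (+),
     smult = (*), star = cnj, cnorm = cmod\<rparr>"

text \<open>
  The pointwise operations and the supremum norm, on all functions from \<open>X\<close> to \<open>B\<close>. This is only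
  a C*-algebra after the carrier is cut down to suitable bounded functions.
\<close>

definition fun_cstar :: "'x topology \<Rightarrow> ('b, 'm) cstar_scheme \<Rightarrow> ('x \<Rightarrow> 'b) cstar" where
  "fun_cstar X B = \<lparr>carrier = topspace X \<rightarrow>\<^sub>E carrier B,
     mult = (\<lambda>F G. \<lambda>x\<in>topspace X. F x \<otimes>\<^bsub>B\<^esub> G x),
     one = (\<lambda>x\<in>topspace X. \<one>\<^bsub>B\<^esub>),
     zero = (\<lambda>x\<in>topspace X. \<zero>\<^bsub>B\<^esub>),
     add = (\<lambda>F G. \<lambda>x\<in>topspace X. F x \<oplus>\<^bsub>B\<^esub> G x),
     smult = (\<lambda>c F. \<lambda>x\<in>topspace X. c \<odot>\<^bsub>B\<^esub> F x),
     star = (\<lambda>F. \<lambda>x\<in>topspace X. star B (F x)),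
     cnorm = (\<lambda>F. SUP x\<in>topspace X. cnorm B (F x))\<rparr>"

definition cont_cstar :: "'x topology \<Rightarrow> ('x \<Rightarrow> complex) cstar" where
  "cont_cstar X = (fun_cstar X complex_cstar)
     \<lparr>carrier := {a \<in> extensional (topspace X). continuous_map X euclidean a}\<rparr>"

definition pullback :: "'x topology \<Rightarrow> ('x \<Rightarrow> 'y) \<Rightarrow> ('y \<Rightarrow> 'b) \<Rightarrow> 'x \<Rightarrow> 'b" where
  "pullback X g a = (\<lambda>x\<in>topspace X. a (g x))"


section \<open>Tensor products of C*-algebras\<close>

inductive_set tensor_span ::
    "('a, 'm) cstar_scheme \<Rightarrow> ('b, 'n) cstar_scheme \<Rightarrow> ('p, 'k) cstar_scheme \<Rightarrow>
     ('a \<Rightarrow> 'b \<Rightarrow> 'p) \<Rightarrow> 'p set"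
  for A B P \<tau> where
  zero: "\<zero>\<^bsub>P\<^esub> \<in> tensor_span A B P \<tau>"
| add: "\<lbrakk>p \<in> tensor_span A B P \<tau>; a \<in> carrier A; b \<in> carrier B\<rbrakk>
    \<Longrightarrow> p \<oplus>\<^bsub>P\<^esub> \<tau> a b \<in> tensor_span A B P \<tau>"

text \<open>
  \<open>P\<close>, with elementary tensors \<open>\<tau> a b\<close>, is a completion of the algebraic tensor product
  *-algebra of \<open>A\<close> and \<open>B\<close> in a C*-norm. If one of the factors is nuclear (for instance commutative
  or finite-dimensional), there is only one such norm, and \<open>P\<close> is the C*-tensor product.
\<close>

definition is_cstar_tensor_product ::
    "('a, 'm) cstar_scheme \<Rightarrow> ('b, 'n) cstar_scheme \<Rightarrow> ('p, 'k) cstar_scheme \<Rightarrow>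
     ('a \<Rightarrow> 'b \<Rightarrow> 'p) \<Rightarrow> bool" where
  "is_cstar_tensor_product A B P \<tau> \<longleftrightarrow>
    unital_cstar_algebra A \<and> unital_cstar_algebra B \<and> unital_cstar_algebra P \<and>
    (\<forall>a\<in>carrier A. \<forall>b\<in>carrier B. \<tau> a b \<in> carrier P) \<and>
    (\<forall>a\<in>carrier A. \<forall>a'\<in>carrier A. \<forall>b\<in>carrier B. \<tau> (a \<oplus>\<^bsub>A\<^esub> a') b = \<tau> a b \<oplus>\<^bsub>P\<^esub> \<tau> a' b) \<and>
    (\<forall>a\<in>carrier A. \<forall>b\<in>carrier B. \<forall>b'\<in>carrier B. \<tau> a (b \<oplus>\<^bsub>B\<^esub> b') = \<tau> a b \<oplus>\<^bsub>P\<^esub> \<tau> a b') \<and>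
    (\<forall>c. \<forall>a\<in>carrier A. \<forall>b\<in>carrier B. \<tau> (c \<odot>\<^bsub>A\<^esub> a) b = c \<odot>\<^bsub>P\<^esub> \<tau> a b) \<and>
    (\<forall>c. \<forall>a\<in>carrier A. \<forall>b\<in>carrier B. \<tau> a (c \<odot>\<^bsub>B\<^esub> b) = c \<odot>\<^bsub>P\<^esub> \<tau> a b) \<and>
    (\<forall>a\<in>carrier A. \<forall>a'\<in>carrier A. \<forall>b\<in>carrier B. \<forall>b'\<in>carrier B.
      \<tau> (a \<otimes>\<^bsub>A\<^esub> a') (b \<otimes>\<^bsub>B\<^esub> b') = \<tau> a b \<otimes>\<^bsub>P\<^esub> \<tau> a' b') \<and>
    \<tau> \<one>\<^bsub>A\<^esub> \<one>\<^bsub>B\<^esub> = \<one>\<^bsub>P\<^esub> \<and>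
    (\<forall>a\<in>carrier A. \<forall>b\<in>carrier B. \<tau> (star A a) (star B b) = star P (\<tau> a b)) \<and>
    (\<forall>(n::nat) a b. a \<in> {..<n} \<rightarrow> carrier A \<and> b \<in> {..<n} \<rightarrow> carrier B \<and>
        (\<forall>c. finsum B (\<lambda>k. c k \<odot>\<^bsub>B\<^esub> b k) {..<n} = \<zero>\<^bsub>B\<^esub> \<longrightarrow> (\<forall>k<n. c k = 0)) \<and>
        finsum P (\<lambda>k. \<tau> (a k) (b k)) {..<n} = \<zero>\<^bsub>P\<^esub>
      \<longrightarrow> (\<forall>k<n. a k = \<zero>\<^bsub>A\<^esub>)) \<and>
    (\<forall>p\<in>carrier P. \<forall>e>0. \<exists>q\<in>tensor_span A B P \<tau>. cnorm P (p \<ominus>\<^bsub>P\<^esub> q) < e)"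

text \<open>
  The spatial tensor product of \<open>C(X)\<close> and \<open>B\<close>, for \<open>C(X)\<close> represented by multiplication on
  \<open>\<ell>\<^sup>2(X)\<close> and \<open>B\<close> on a Hilbert space \<open>K\<close>: on \<open>\<ell>\<^sup>2(X) \<otimes> K = \<ell>\<^sup>2(X, K)\<close> the elementary tensor
  of \<open>a\<close> and \<open>b\<close> is the diagonal operator with entries \<open>a(x)b\<close>, a diagonal operator is given by
  the function of its entries, and its norm is the supremum of the norms of the entries. So the
  tensor product is the closed linear span of the functions \<open>x \<mapsto> a(x)b\<close> in the supremum norm.
  That it is a C*-tensor product is theorem \<open>is_cstar_tensor_product_cont_tensor\<close> below.
\<close>

definition elem_tensor ::
    "'x topology \<Rightarrow> ('b, 'm) cstar_scheme \<Rightarrow> ('x \<Rightarrow> complex) \<Rightarrow> 'b \<Rightarrow> 'x \<Rightarrow> 'b" where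
  "elem_tensor X B a b = (\<lambda>x\<in>topspace X. a x \<odot>\<^bsub>B\<^esub> b)"

definition cont_tensor :: "'x topology \<Rightarrow> ('b, 'm) cstar_scheme \<Rightarrow> ('x \<Rightarrow> 'b) cstar" where
  "cont_tensor X B = (fun_cstar X B)
     \<lparr>carrier := {F \<in> topspace X \<rightarrow>\<^sub>E carrier B.
        \<forall>e>0. \<exists>G \<in> tensor_span (cont_cstar X) B (fun_cstar X B) (elem_tensor X B).
          \<forall>x\<in>topspace X. cnorm B (F x \<ominus>\<^bsub>B\<^esub> G x) < e}\<rparr>"

text \<open>
  For \<open>g\<close> from \<open>X\<close> to \<open>Y\<close>, the map \<open>g\<^sup>\<star> \<otimes> id\<close> from \<open>C(Y) \<otimes> B\<close> to \<open>C(X) \<otimes> B\<close>. It is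
  determined by its values on elementary tensors, see \<open>pullback_tensor_elem\<close> and
  \<open>pullback_tensor_unique\<close> below.
\<close>

definition pullback_tensor :: "'x topology \<Rightarrow> ('x \<Rightarrow> 'y) \<Rightarrow> ('y \<Rightarrow> 'b) \<Rightarrow> 'x \<Rightarrow> 'b" where
  "pullback_tensor X g F = (\<lambda>x\<in>topspace X. F (g x))"


section \<open>The operators on a finite-dimensional Hilbert space\<close>

text \<open>
  A nonzero finite-dimensional complex Hilbert space is a Euclidean space (a real inner product
  space of finite nonzero dimension) with a complex structure and a Hermitian inner product, linear
  in the second argument, whose real part is the given inner product.
\<close>

class complex_euclidean_space = euclidean_space +
  fixes scaleC :: "complex \<Rightarrow> 'a \<Rightarrow> 'a" (infixr \<open>*\<^sub>C\<close> 75)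
    and cinner :: "'a \<Rightarrow> 'a \<Rightarrow> complex"
  assumes scaleC_add_right: "c *\<^sub>C (x + y) = c *\<^sub>C x + c *\<^sub>C y"
    and scaleC_add_left: "(c + d) *\<^sub>C x = c *\<^sub>C x + d *\<^sub>C x"
    and scaleC_scaleC: "c *\<^sub>C d *\<^sub>C x = (c * d) *\<^sub>C x"
    and scaleC_of_real: "of_real r *\<^sub>C x = r *\<^sub>R x"
    and cinner_add_right: "cinner x (y + z) = cinner x y + cinner x z"
    and cinner_scaleC_right: "cinner x (c *\<^sub>C y) = c * cinner x y"
    and cinner_commute: "cinner x y = cnj (cinner y x)"
    and Re_cinner: "Re (cinner x y) = x \<bullet> y"

text \<open>
  The complex-linear operators. In finite dimension all of them are bounded (\<open>complex_linear_op\<close>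
  below), so nothing is lost by taking them from the type \<open>'h \<Rightarrow>\<^sub>L 'h\<close>, which carries the operator
  norm. The adjoint exists by \<open>star_op\<close>.
\<close>

definition op_cstar :: "('h::complex_euclidean_space \<Rightarrow>\<^sub>L 'h) cstar" where
  "op_cstar = \<lparr>carrier = {T. \<forall>c x. blinfun_apply T (c *\<^sub>C x) = c *\<^sub>C blinfun_apply T x},
     mult = (o\<^sub>L), one = id_blinfun, zero = 0, add = (+),
     smult = (\<lambda>c T. Blinfun (\<lambda>x. c *\<^sub>C blinfun_apply T x)),
     star = (\<lambda>T. THE S. \<forall>x y. cinner (blinfun_apply S x) y = cinner x (blinfun_apply T y)),
     cnorm = norm\<rparr>"


section \<open>Quantum nullhomotopic loops\<close>

definition circle :: "complex topology" where
  "circle = top_of_set (sphere 0 1)"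

definition disk :: "complex topology" where
  "disk = top_of_set (cball 0 1)"

definition loop :: "'t topology \<Rightarrow> (complex \<Rightarrow> 't) \<Rightarrow> bool" where
  "loop T f \<longleftrightarrow> compact_space T \<and> Hausdorff_space T \<and> continuous_map circle T f"

text \<open>
  The Hilbert space is a type parameter, since a type cannot be bound by an existential quantifier:
  \<open>quantum_nullhomotopic TYPE('h) T f\<close> says that \<open>'h\<close> is a Hilbert space as required for \<open>f\<close> to be
  quantum nullhomotopic. That \<open>f\<close> is not quantum nullhomotopic is thus the negation of this for
  arbitrary \<open>'h\<close>. The inclusion \<open>j\<close> of the circle in the disk is \<open>\<lambda>x. x\<close>.
\<close>

definition quantum_nullhomotopic ::
    "'h::complex_euclidean_space itself \<Rightarrow> 't topology \<Rightarrow> (complex \<Rightarrow> 't) \<Rightarrow> bool" where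
  "quantum_nullhomotopic _ T f \<longleftrightarrow>
    (\<exists>\<phi> \<in> unital_star_hom (cont_cstar T) (cont_tensor disk (op_cstar :: ('h \<Rightarrow>\<^sub>L 'h) cstar)).
      \<forall>a \<in> carrier (cont_cstar T).
        pullback_tensor circle (\<lambda>x. x) (\<phi> a) =
        elem_tensor circle op_cstar (pullback circle f a) \<one>\<^bsub>op_cstar\<^esub>)"


section \<open>Adequacy of the definitions\<close>

subsection \<open>Algebras of functions\<close>

context unital_cstar_algebra
begin

sublocale Q: ring A by (rule ring)

lemma smult_cl [simp]: "x \<in> carrier A \<Longrightarrow> c \<odot> x \<in> carrier A"
  using module.smult_closed[OF module, of c x] by (simp add: complex_ring_def)

lemma minus_smult: "x \<in> carrier A \<Longrightarrow> \<ominus> x = (-1) \<odot> x"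
proof -
  assume x: "x \<in> carrier A"
  have "((-1) \<oplus>\<^bsub>complex_ring\<^esub> 1) \<odot> x = (-1) \<odot> x \<oplus> 1 \<odot> x"
    using x by (intro module.smult_l_distr[OF module]) (auto simp: complex_ring_def)
  moreover have "1 \<odot> x = x" using module.smult_one[OF module x] by (simp add: complex_ring_def)
  moreover have "0 \<odot> x = \<zero>" using module.smult_l_null[OF module x] by (simp add: complex_ring_def)
  ultimately have "(-1) \<odot> x \<oplus> x = \<zero>" by (simp add: complex_ring_def)
  then show ?thesis using x by (simp add: Q.minus_equality)
qed

lemma smult_add_l: "x \<in> carrier A \<Longrightarrow> (c + d) \<odot> x = c \<odot> x \<oplus> d \<odot> x"
  using module.smult_l_distr[OF module, of c d x] by (simp add: complex_ring_def)

lemma smult_add_r: "\<lbrakk>x \<in> carrier A; y \<in> carrier A\<rbrakk> \<Longrightarrow> c \<odot> (x \<oplus> y) = c \<odot> x \<oplus> c \<odot> y"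
  using module.smult_r_distr[OF module, of c x y] by (simp add: complex_ring_def)

lemma smult_smult: "x \<in> carrier A \<Longrightarrow> (c * d) \<odot> x = c \<odot> (d \<odot> x)"
  using module.smult_assoc1[OF module, of c d x] by (simp add: complex_ring_def)

lemma smult_1 [simp]: "x \<in> carrier A \<Longrightarrow> 1 \<odot> x = x"
  using module.smult_one[OF module, of x] by (simp add: complex_ring_def)

lemma smult_0 [simp]: "x \<in> carrier A \<Longrightarrow> 0 \<odot> x = \<zero>"
  using module.smult_l_null[OF module, of x] by (simp add: complex_ring_def)

lemma smult_zero [simp]: "c \<odot> \<zero> = \<zero>"
  using module.smult_r_null[OF module, of c] by (simp add: complex_ring_def)

lemma cnorm_zero [simp]: "cnorm A \<zero> = 0"
  by (simp add: cnorm_eq_0)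

lemma cnorm_uminus [simp]: "x \<in> carrier A \<Longrightarrow> cnorm A (\<ominus> x) = cnorm A x"
  by (simp add: minus_smult cnorm_smult)

lemma cnorm_nonneg [simp]: "x \<in> carrier A \<Longrightarrow> 0 \<le> cnorm A x"
  using cnorm_add[of x "\<ominus> x"] by (simp add: Q.r_neg)

lemma cnorm_star [simp]: "x \<in> carrier A \<Longrightarrow> cnorm A (star A x) = cnorm A x"
proof -
  have *: "cnorm A x \<le> cnorm A (star A x)" if x: "x \<in> carrier A" for x
  proof (cases "cnorm A x = 0")
    case False
    have "(cnorm A x)\<^sup>2 \<le> cnorm A (star A x) * cnorm A x"
      using cnorm_mult[of "star A x" x] x by (simp add: cnorm_star_mult star_closed)
    then show ?thesis using False cnorm_nonneg[OF x] by (simp add: power2_eq_square)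
  qed (simp add: x star_closed)
  assume x: "x \<in> carrier A"
  show ?thesis using *[OF x] *[OF star_closed[OF x]] x by (simp add: star_star)
qed

lemma star_zero [simp]: "star A \<zero> = \<zero>"
  using star_smult[of \<zero> 0] by (simp add: star_closed)

lemma star_one [simp]: "star A \<one> = \<one>"
proof -
  have "star A \<one> = star A \<one> \<otimes> \<one>" by (simp add: star_closed)
  also have "\<dots> = star A (star A \<one>) " 
    by (metis Q.l_one Q.one_closed star_closed star_mult star_star)
  finally show ?thesis by (simp add: star_star)
qed

lemma star_uminus: "x \<in> carrier A \<Longrightarrow> star A (\<ominus> x) = \<ominus> star A x"
  by (simp add: minus_smult star_smult star_closed)

lemma diff_triangle:
  assumes "x \<in> carrier A" "y \<in> carrier A" "z \<in> carrier A"
  shows "cnorm A (x \<ominus> z) \<le> cnorm A (x \<ominus> y) + cnorm A (y \<ominus> z)"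
proof -
  have "x \<ominus> z = (x \<ominus> y) \<oplus> (y \<ominus> z)"
    using assms by (simp add: a_minus_def Q.a_assoc Q.l_neg Q.r_neg1 Q.r_neg2)
  then show ?thesis using assms by (simp add: cnorm_add)
qed

lemma diff_commute:
  assumes "x \<in> carrier A" "y \<in> carrier A"
  shows "cnorm A (x \<ominus> y) = cnorm A (y \<ominus> x)"
proof -
  have "x \<ominus> y = \<ominus> (y \<ominus> x)"
    using assms by (simp add: a_minus_def Q.minus_add Q.a_comm)
  then show ?thesis using assms by simp
qed

lemma cnorm_le_diff:
  assumes "x \<in> carrier A" "y \<in> carrier A"
  shows "cnorm A x \<le> cnorm A (x \<ominus> y) + cnorm A y"
proof -
  have "x = (x \<ominus> y) \<oplus> y"
    using assms by (simp add: a_minus_def Q.a_assoc Q.l_neg)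
  then show ?thesis using cnorm_add[of "x \<ominus> y" y] assms by simp
qed

lemma diff_add:
  assumes "x \<in> carrier A" "y \<in> carrier A" "x' \<in> carrier A" "y' \<in> carrier A"
  shows "cnorm A ((x \<oplus> x') \<ominus> (y \<oplus> y')) \<le> cnorm A (x \<ominus> y) + cnorm A (x' \<ominus> y')"
proof -
  have "(x \<oplus> x') \<ominus> (y \<oplus> y') = (x \<ominus> y) \<oplus> (x' \<ominus> y')"
    using assms by (simp add: a_minus_def Q.minus_add Q.a_ac)
  then show ?thesis using assms by (simp add: cnorm_add)
qed

lemma diff_smult:
  assumes "x \<in> carrier A" "y \<in> carrier A"
  shows "cnorm A (c \<odot> x \<ominus> c \<odot> y) = cmod c * cnorm A (x \<ominus> y)"
proof -
  have "c \<odot> x \<ominus> c \<odot> y = c \<odot> (x \<ominus> y)"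
    using assms by (simp add: a_minus_def smult_add_r minus_smult flip: smult_smult)
  then show ?thesis using assms by (simp add: cnorm_smult)
qed

lemma diff_star:
  assumes "x \<in> carrier A" "y \<in> carrier A"
  shows "cnorm A (star A x \<ominus> star A y) = cnorm A (x \<ominus> y)"
proof -
  have "star A x \<ominus> star A y = star A (x \<ominus> y)"
    using assms by (simp add: a_minus_def star_add star_uminus)
  then show ?thesis using assms by simp
qed

lemma diff_mult:
  assumes "x \<in> carrier A" "y \<in> carrier A" "x' \<in> carrier A" "y' \<in> carrier A"
  shows "cnorm A ((x \<otimes> x') \<ominus> (y \<otimes> y')) \<le>
    cnorm A (x \<ominus> y) * cnorm A x' + cnorm A y * cnorm A (x' \<ominus> y')"
proof -
  have "(x \<otimes> x') \<ominus> (y \<otimes> y') = (x \<ominus> y) \<otimes> x' \<oplus> y \<otimes> (x' \<ominus> y')"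
    using assms 
    by (simp add: a_minus_def Q.l_distr Q.r_distr Q.l_minus Q.r_minus Q.a_assoc Q.r_neg1 Q.r_neg2)
  then have "cnorm A ((x \<otimes> x') \<ominus> (y \<otimes> y')) \<le>
     cnorm A ((x \<ominus> y) \<otimes> x') + cnorm A (y \<otimes> (x' \<ominus> y'))"
    using assms by (simp add: cnorm_add)
  then show ?thesis using assms cnorm_mult[of "x \<ominus> y" x'] cnorm_mult[of y "x' \<ominus> y'"] by simp
qed

lemma diff_eq_0: 
  assumes "x \<in> carrier A" "y \<in> carrier A" "cnorm A (x \<ominus> y) \<le> 0"
  shows "x = y"
proof -
  have "cnorm A (x \<ominus> y) = 0"
    using assms cnorm_nonneg[of "x \<ominus> y"] by (intro antisym) auto
  then have "x \<ominus> y = \<zero>" using assms cnorm_eq_0[of "x \<ominus> y"] by simp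
  moreover have "x = (x \<ominus> y) \<oplus> y"
    using assms by (simp add: a_minus_def Q.a_assoc Q.l_neg)
  ultimately show ?thesis using assms by simp
qed

lemma cnorm_star_mult_right: "x \<in> carrier A \<Longrightarrow> cnorm A (x \<otimes> star A x) = (cnorm A x)\<^sup>2"
  using cnorm_star_mult[of "star A x"] by (simp add: star_closed star_star)

end

context unital_cstar_algebra
begin

lemma fun_cstar_subalgebra:
  fixes X :: "'x topology" and S
  defines "P \<equiv> (fun_cstar X A)\<lparr>carrier := S\<rparr>"
  assumes X: "topspace X \<noteq> {}"
    and S: "S \<subseteq> topspace X \<rightarrow>\<^sub>E carrier A"
    and one: "\<one>\<^bsub>P\<^esub> \<in> S"
    and add: "\<And>F G. \<lbrakk>F \<in> S; G \<in> S\<rbrakk> \<Longrightarrow> F \<oplus>\<^bsub>P\<^esub> G \<in> S"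
    and mult: "\<And>F G. \<lbrakk>F \<in> S; G \<in> S\<rbrakk> \<Longrightarrow> F \<otimes>\<^bsub>P\<^esub> G \<in> S"
    and smult: "\<And>c F. F \<in> S \<Longrightarrow> c \<odot>\<^bsub>P\<^esub> F \<in> S"
    and star: "\<And>F. F \<in> S \<Longrightarrow> star P F \<in> S"
    and bdd: "\<And>F. F \<in> S \<Longrightarrow> bdd_above ((\<lambda>x. cnorm A (F x)) ` topspace X)"
    and cl: "\<And>F. \<lbrakk>F \<in> topspace X \<rightarrow>\<^sub>E carrier A;
      \<And>e. e > 0 \<Longrightarrow> \<exists>G\<in>S. \<forall>x\<in>topspace X. cnorm A (F x \<ominus> G x) < e\<rbrakk> \<Longrightarrow> F \<in> S"
  shows "unital_cstar_algebra P"
    and "\<And>F G. \<lbrakk>F \<in> S; G \<in> S\<rbrakk> \<Longrightarrow> F \<ominus>\<^bsub>P\<^esub> G = (\<lambda>x\<in>topspace X. F x \<ominus> G x)"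
proof -
  let ?X = "topspace X"
  have P: "carrier P = S" "\<one>\<^bsub>P\<^esub> = (\<lambda>x\<in>?X. \<one>)" "\<zero>\<^bsub>P\<^esub> = (\<lambda>x\<in>?X. \<zero>)"
    "\<And>F G. F \<oplus>\<^bsub>P\<^esub> G = (\<lambda>x\<in>?X. F x \<oplus> G x)" "\<And>F G. F \<otimes>\<^bsub>P\<^esub> G = (\<lambda>x\<in>?X. F x \<otimes> G x)"
    "\<And>c F. c \<odot>\<^bsub>P\<^esub> F = (\<lambda>x\<in>?X. c \<odot> F x)" "\<And>F. star P F = (\<lambda>x\<in>?X. star A (F x))"
    "\<And>F. cnorm P F = (SUP x\<in>?X. cnorm A (F x))"
    by (simp_all add: P_def fun_cstar_def)
  have mem: "F x \<in> carrier A" if "F \<in> S" "x \<in> ?X" for F x using that S by auto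
  have ext': "F = G" if "F \<in> S" "G \<in> S" "\<And>x. x \<in> ?X \<Longrightarrow> F x = G x" for F G
  proof (rule extensionalityI[of _ ?X])
    show "F \<in> extensional ?X" "G \<in> extensional ?X"
      using that(1,2) S by (auto simp: PiE_def)
  qed (rule that(3))
  have "0 \<odot>\<^bsub>P\<^esub> \<one>\<^bsub>P\<^esub> = \<zero>\<^bsub>P\<^esub>"
    unfolding P by (rule restrict_ext) simp
  then have zero: "\<zero>\<^bsub>P\<^esub> \<in> S"
    using smult[OF one, of 0] by simp
  note mems = one add mult smult star zero
  have inv: "((-1) \<odot>\<^bsub>P\<^esub> F) \<oplus>\<^bsub>P\<^esub> F = \<zero>\<^bsub>P\<^esub>" if F: "F \<in> S" for F
    by (rule ext', simp add: mems F, simp add: mems F,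
        simp add: P mem[OF F] Q.l_neg flip: minus_smult)
  have grp: "abelian_group P"
  proof (rule abelian_groupI, unfold P(1))
    fix F assume F: "F \<in> S"
    show "\<exists>y\<in>S. y \<oplus>\<^bsub>P\<^esub> F = \<zero>\<^bsub>P\<^esub>" using inv[OF F] smult[OF F] by blast
    show "\<zero>\<^bsub>P\<^esub> \<oplus>\<^bsub>P\<^esub> F = F"
      by (rule ext', simp add: mems F, simp add: mems F,
        simp add: P mem[OF F] )
    fix G assume G: "G \<in> S"
    show "F \<oplus>\<^bsub>P\<^esub> G = G \<oplus>\<^bsub>P\<^esub> F"
      by (rule ext', simp add: mems F G, simp add: mems F G,
        simp add: P mem[OF F] mem[OF G] Q.a_comm)
    fix H assume H: "H \<in> S"
    show "F \<oplus>\<^bsub>P\<^esub> G \<oplus>\<^bsub>P\<^esub> H = F \<oplus>\<^bsub>P\<^esub> (G \<oplus>\<^bsub>P\<^esub> H)"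
      by (rule ext', simp add: mems F G H, simp add: mems F G H,
        simp add: P mem[OF F] mem[OF G] mem[OF H] Q.a_assoc)
  qed (simp_all add: mems)
  have mon: "Group.monoid P"
  proof (rule monoidI, unfold P(1))
    fix F assume F: "F \<in> S"
    show "\<one>\<^bsub>P\<^esub> \<otimes>\<^bsub>P\<^esub> F = F" "F \<otimes>\<^bsub>P\<^esub> \<one>\<^bsub>P\<^esub> = F"
      by (rule ext', simp add: mems F, simp add: mems F,
        simp add: P mem[OF F] )+
    fix G assume G: "G \<in> S"
    fix H assume H: "H \<in> S"
    show "F \<otimes>\<^bsub>P\<^esub> G \<otimes>\<^bsub>P\<^esub> H = F \<otimes>\<^bsub>P\<^esub> (G \<otimes>\<^bsub>P\<^esub> H)"
      by (rule ext', simp add: mems F G H, simp add: mems F G H,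
        simp add: P mem[OF F] mem[OF G] mem[OF H] Q.m_assoc)
  qed (simp_all add: mems)
  have rng: "ring P"
  proof (rule ringI[OF grp mon], unfold P(1))
    fix F G H assume F: "F \<in> S" and G: "G \<in> S" and H: "H \<in> S"
    show "(F \<oplus>\<^bsub>P\<^esub> G) \<otimes>\<^bsub>P\<^esub> H = F \<otimes>\<^bsub>P\<^esub> H \<oplus>\<^bsub>P\<^esub> G \<otimes>\<^bsub>P\<^esub> H"
         "H \<otimes>\<^bsub>P\<^esub> (F \<oplus>\<^bsub>P\<^esub> G) = H \<otimes>\<^bsub>P\<^esub> F \<oplus>\<^bsub>P\<^esub> H \<otimes>\<^bsub>P\<^esub> G"
      by (rule ext', simp add: mems F G H, simp add: mems F G H,
        simp add: P mem[OF F] mem[OF G] mem[OF H] Q.l_distr Q.r_distr)+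
  qed
  interpret P: ring P by (rule rng)
  have cr: "cring complex_ring"
  proof (rule cringI)
    show "abelian_group complex_ring"
    proof (rule abelian_groupI)
      fix x assume "x \<in> carrier complex_ring"
      show "\<exists>y\<in>carrier complex_ring. y \<oplus>\<^bsub>complex_ring\<^esub> x = \<zero>\<^bsub>complex_ring\<^esub>"
        by (rule bexI[of _ "- x"]) (simp_all add: complex_ring_def)
    qed (simp_all add: complex_ring_def)
    show "comm_monoid complex_ring"
      by (rule comm_monoidI) (simp_all add: complex_ring_def)
  qed (simp_all add: complex_ring_def algebra_simps)
  have mod: "module complex_ring P"
  proof (rule moduleI[OF cr grp], unfold P(1))
    fix c d F G assume F: "F \<in> S" and G: "G \<in> S"
    show "(c \<oplus>\<^bsub>complex_ring\<^esub> d) \<odot>\<^bsub>P\<^esub> F = c \<odot>\<^bsub>P\<^esub> F \<oplus>\<^bsub>P\<^esub> d \<odot>\<^bsub>P\<^esub> F"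
      "c \<odot>\<^bsub>P\<^esub> (F \<oplus>\<^bsub>P\<^esub> G) = c \<odot>\<^bsub>P\<^esub> F \<oplus>\<^bsub>P\<^esub> c \<odot>\<^bsub>P\<^esub> G"
      "(c \<otimes>\<^bsub>complex_ring\<^esub> d) \<odot>\<^bsub>P\<^esub> F = c \<odot>\<^bsub>P\<^esub> (d \<odot>\<^bsub>P\<^esub> F)"
      "\<one>\<^bsub>complex_ring\<^esub> \<odot>\<^bsub>P\<^esub> F = F"
      by (rule ext', simp add: mems F G, simp add: mems F G,
        simp add: P mem[OF F] mem[OF G] complex_ring_def smult_add_l smult_add_r smult_smult)+
  qed (simp_all add: mems)
  show minus: "F \<ominus>\<^bsub>P\<^esub> G = (\<lambda>x\<in>?X. F x \<ominus> G x)" if F: "F \<in> S" and G: "G \<in> S" for F G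
  proof -
    have "\<ominus>\<^bsub>P\<^esub> G = (-1) \<odot>\<^bsub>P\<^esub> G"
      using inv[OF G] G smult[OF G] by (intro P.minus_equality) (auto simp: P(1))
    then show ?thesis
      using mem[OF F] mem[OF G] by (simp add: a_minus_def P fun_eq_iff minus_smult)
  qed
  have nonneg: "0 \<le> cnorm P F" if F: "F \<in> S" for F
  proof -
    obtain x where x: "x \<in> ?X" using X by blast
    show ?thesis unfolding P
      by (rule cSUP_upper2[OF bdd[OF F] x]) (use mem[OF F x] in simp)
  qed
  have upper: "cnorm A (F x) \<le> cnorm P F" if "F \<in> S" "x \<in> ?X" for F x
    unfolding P using bdd[OF that(1)] that(2) by (rule cSUP_upper2) simp
  have least: "cnorm P F \<le> C" if "\<And>x. x \<in> ?X \<Longrightarrow> cnorm A (F x) \<le> C" for F C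
    unfolding P using that X by (intro cSUP_least) auto
  have diff_in: "F \<ominus>\<^bsub>P\<^esub> G \<in> S" if "F \<in> S" "G \<in> S" for F G
    using P.minus_closed[of F G] that by (simp add: P(1))
  show "unital_cstar_algebra P"
  proof (rule unital_cstar_algebra.intro, unfold P(1))
    show "module complex_ring P" "ring P" by (rule mod, rule rng)
    fix F assume F: "F \<in> S"
    show "star P F \<in> S" using star[OF F] .
    show "star P (star P F) = F"
      by (rule ext', simp add: mems F, simp add: mems F,
        simp add: P mem[OF F] star_star)
    show "star P (c \<odot>\<^bsub>P\<^esub> F) = cnj c \<odot>\<^bsub>P\<^esub> star P F" for c
      by (rule ext', simp add: mems F, simp add: mems F,
        simp add: P mem[OF F] star_smult)
    show "(cnorm P F = 0) = (F = \<zero>\<^bsub>P\<^esub>)"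
    proof
      assume 0: "cnorm P F = 0"
      show "F = \<zero>\<^bsub>P\<^esub>"
      proof (rule ext'[OF F zero])
        fix x assume x: "x \<in> ?X"
        have "cnorm A (F x) = 0"
          using upper[OF F x] cnorm_nonneg[OF mem[OF F x]] 0 by simp
        then show "F x = \<zero>\<^bsub>P\<^esub> x" using cnorm_eq_0[OF mem[OF F x]] x by (simp add: P(3))
      qed
    next
      assume "F = \<zero>\<^bsub>P\<^esub>"
      then have "cnorm P F \<le> 0" by (intro least) (simp add: P(3))
      then show "cnorm P F = 0" using nonneg[OF F] by simp
    qed
    have le: "cnorm P (c \<odot>\<^bsub>P\<^esub> F) \<le> cmod c * cnorm P F" if F: "F \<in> S" for c F
      by (rule least) (use upper[OF F] mem[OF F] in \<open>auto simp: P(6) cnorm_smult mult_left_mono\<close>)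
    show "cnorm P (c \<odot>\<^bsub>P\<^esub> F) = cmod c * cnorm P F" for c
    proof (cases "c = 0")
      case True
      then show ?thesis using le[OF F, of c] nonneg[OF smult[OF F], of c] by simp
    next
      case False
      have "F = inverse c \<odot>\<^bsub>P\<^esub> (c \<odot>\<^bsub>P\<^esub> F)"
        by (rule ext', simp add: mems F, simp add: mems F,
        simp add: P False mem[OF F]  flip: smult_smult)
      then have "cnorm P F \<le> cmod (inverse c) * cnorm P (c \<odot>\<^bsub>P\<^esub> F)"
        using le[OF smult[OF F], of "inverse c" c] by simp
      then have "cmod c * cnorm P F \<le> cnorm P (c \<odot>\<^bsub>P\<^esub> F)"
        using False by (simp add: norm_inverse norm_divide field_simps)
      then show ?thesis using le[OF F, of c] by simp
    qed
    show "cnorm P (star P F \<otimes>\<^bsub>P\<^esub> F) = (cnorm P F)\<^sup>2"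
    proof (rule antisym)
      show "cnorm P (star P F \<otimes>\<^bsub>P\<^esub> F) \<le> (cnorm P F)\<^sup>2"
        by (rule least) (use upper[OF F] mem[OF F] in \<open>auto simp: P(5,7) cnorm_star_mult power_mono\<close>)
      have "cnorm A (F x) \<le> sqrt (cnorm P (star P F \<otimes>\<^bsub>P\<^esub> F))" if x: "x \<in> ?X" for x
        using upper[OF mult[OF star[OF F] F] x] x mem[OF F x]
        by (intro real_le_rsqrt) (simp add: P(5,7) cnorm_star_mult)
      then have "cnorm P F \<le> sqrt (cnorm P (star P F \<otimes>\<^bsub>P\<^esub> F))" by (rule least)
      then show "(cnorm P F)\<^sup>2 \<le> cnorm P (star P F \<otimes>\<^bsub>P\<^esub> F)"
        using nonneg[OF F] nonneg[OF mult[OF star[OF F] F]] by (simp add: sqrt_ge_absD)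
    qed
    fix G assume G: "G \<in> S"
    show "(c \<odot>\<^bsub>P\<^esub> F) \<otimes>\<^bsub>P\<^esub> G = c \<odot>\<^bsub>P\<^esub> (F \<otimes>\<^bsub>P\<^esub> G)"
      "F \<otimes>\<^bsub>P\<^esub> (c \<odot>\<^bsub>P\<^esub> G) = c \<odot>\<^bsub>P\<^esub> (F \<otimes>\<^bsub>P\<^esub> G)" for c
      by (rule ext', simp add: mems F G, simp add: mems F G,
        simp add: P mem[OF F] mem[OF G] smult_mult_left smult_mult_right)+
    show "star P (F \<oplus>\<^bsub>P\<^esub> G) = star P F \<oplus>\<^bsub>P\<^esub> star P G"
      "star P (F \<otimes>\<^bsub>P\<^esub> G) = star P G \<otimes>\<^bsub>P\<^esub> star P F"
      by (rule ext', simp add: mems F G, simp add: mems F G,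
        simp add: P mem[OF F] mem[OF G] star_add star_mult)+
    show "cnorm P (F \<oplus>\<^bsub>P\<^esub> G) \<le> cnorm P F + cnorm P G"
    proof (rule least)
      fix x assume x: "x \<in> ?X"
      show "cnorm A ((F \<oplus>\<^bsub>P\<^esub> G) x) \<le> cnorm P F + cnorm P G"
        using cnorm_add[OF mem[OF F x] mem[OF G x]] upper[OF F x] upper[OF G x] x
        by (simp add: P(4))
    qed
    show "cnorm P (F \<otimes>\<^bsub>P\<^esub> G) \<le> cnorm P F * cnorm P G"
    proof (rule least)
      fix x assume x: "x \<in> ?X"
      have "cnorm A (F x) * cnorm A (G x) \<le> cnorm P F * cnorm P G"
        using mem[OF F x] mem[OF G x] upper[OF F x] upper[OF G x] nonneg[OF F]
        by (intro mult_mono) auto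
      then show "cnorm A ((F \<otimes>\<^bsub>P\<^esub> G) x) \<le> cnorm P F * cnorm P G"
        using cnorm_mult[OF mem[OF F x] mem[OF G x]] x by (simp add: P(5))
    qed
  next
    fix s assume s: "\<And>n::nat. s n \<in> S"
      and cau: "\<And>e. e > 0 \<Longrightarrow> \<exists>N. \<forall>m\<ge>N. \<forall>n\<ge>N. cnorm P (s m \<ominus>\<^bsub>P\<^esub> s n) < e"
    have pt: "cnorm A (s m x \<ominus> s n x) \<le> cnorm P (s m \<ominus>\<^bsub>P\<^esub> s n)" if "x \<in> ?X" for x m n
      using upper[OF diff_in[OF s s] that, of m n] that by (simp add: minus[OF s s])
    have "\<exists>l. l \<in> carrier A \<and> (\<lambda>n. cnorm A (s n x \<ominus> l)) \<longlonglongrightarrow> 0" if x: "x \<in> ?X" for x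
    proof -
      have "\<exists>l\<in>carrier A. (\<lambda>n. cnorm A (s n x \<ominus> l)) \<longlonglongrightarrow> 0"
      proof (rule complete)
        show "s n x \<in> carrier A" for n using mem[OF s x] .
        fix e :: real assume "e > 0"
        from cau[OF this] show "\<exists>N. \<forall>m\<ge>N. \<forall>n\<ge>N. cnorm A (s m x \<ominus> s n x) < e"
          using pt[OF x] by (meson le_less_trans)
      qed
      then show ?thesis by blast
    qed
    then obtain l0 where l0: "\<And>x. x \<in> ?X \<Longrightarrow> l0 x \<in> carrier A"
      "\<And>x. x \<in> ?X \<Longrightarrow> (\<lambda>n. cnorm A (s n x \<ominus> l0 x)) \<longlonglongrightarrow> 0" by metis
    define l where "l = restrict l0 ?X"
    have l: "l \<in> ?X \<rightarrow>\<^sub>E carrier A" using l0 by (auto simp: l_def)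
    have unif: "\<exists>N. \<forall>n\<ge>N. \<forall>x\<in>?X. cnorm A (s n x \<ominus> l x) \<le> e" if "e > 0" for e
    proof -
      from cau[OF that] obtain N where N: "\<And>m n. m \<ge> N \<Longrightarrow> n \<ge> N \<Longrightarrow> cnorm P (s m \<ominus>\<^bsub>P\<^esub> s n) < e"
        by blast
      have "cnorm A (s n x \<ominus> l x) \<le> e" if n: "n \<ge> N" and x: "x \<in> ?X" for n x
      proof (rule LIMSEQ_le_const)
        show "(\<lambda>m. e + cnorm A (s m x \<ominus> l x)) \<longlonglongrightarrow> e"
          using tendsto_add[OF tendsto_const l0(2)[OF x], of e] x by (simp add: l_def)
        have "cnorm A (s n x \<ominus> l x) \<le> e + cnorm A (s m x \<ominus> l x)" if m: "m \<ge> N" for m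
        proof -
          have "l x \<in> carrier A" using l x by auto
          from diff_triangle[OF mem[OF s x] mem[OF s x] this, of n m] show ?thesis
            using pt[OF x, of n m] N[OF n m] by linarith
        qed
        then show "\<exists>N. \<forall>m\<ge>N. cnorm A (s n x \<ominus> l x) \<le> e + cnorm A (s m x \<ominus> l x)" by blast
      qed
      then show ?thesis by blast
    qed
    have lS: "l \<in> S"
    proof (rule cl[OF l])
      fix e :: real assume e: "e > 0"
      obtain n where n: "\<forall>x\<in>?X. cnorm A (s n x \<ominus> l x) \<le> e / 2" using unif[of "e/2"] e by auto
      have "\<forall>x\<in>?X. cnorm A (l x \<ominus> s n x) < e"
      proof
        fix x assume x: "x \<in> ?X"
        show "cnorm A (l x \<ominus> s n x) < e"
        proof -
          have "l x \<in> carrier A" using l x by auto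
          then show ?thesis
            using n[rule_format, OF x] e diff_commute[of "l x" "s n x"] mem[OF s x, of n] by simp
        qed
      qed
      then show "\<exists>G\<in>S. \<forall>x\<in>?X. cnorm A (l x \<ominus> G x) < e" using s by blast
    qed
    have "(\<lambda>n. cnorm P (s n \<ominus>\<^bsub>P\<^esub> l)) \<longlonglongrightarrow> 0"
    proof (rule LIMSEQ_I)
      fix e :: real assume e: "e > 0"
      obtain N where N: "\<And>n x. n \<ge> N \<Longrightarrow> x \<in> ?X \<Longrightarrow> cnorm A (s n x \<ominus> l x) \<le> e / 2"
        using unif[of "e/2"] e by auto
      have "cnorm P (s n \<ominus>\<^bsub>P\<^esub> l) \<le> e/2" if "n \<ge> N" for n
        by (rule least) (use N[OF that] in \<open>simp add: minus[OF s lS]\<close>)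
      then show "\<exists>N. \<forall>n\<ge>N. norm (cnorm P (s n \<ominus>\<^bsub>P\<^esub> l) - 0) < e"
        using e nonneg[OF diff_in[OF s lS]] by (intro exI[of _ N]) (force intro: le_less_trans)
    qed
    with lS show "\<exists>l\<in>S. (\<lambda>n. cnorm P (s n \<ominus>\<^bsub>P\<^esub> l)) \<longlonglongrightarrow> 0" by blast
  qed
qed

end

lemma complex_cstar_sel:
  "carrier complex_cstar = UNIV" "mult complex_cstar = (*)" "one complex_cstar = 1"
  "zero complex_cstar = 0" "add complex_cstar = (+)" "smult complex_cstar = (*)"
  "star complex_cstar = cnj" "cnorm complex_cstar = cmod"
  by (simp_all add: complex_cstar_def)

lemma cring_complex_ring: "cring complex_ring"
proof (rule cringI)
  show "abelian_group complex_ring"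
  proof (rule abelian_groupI)
    fix x assume "x \<in> carrier complex_ring"
    show "\<exists>y\<in>carrier complex_ring. y \<oplus>\<^bsub>complex_ring\<^esub> x = \<zero>\<^bsub>complex_ring\<^esub>"
      by (rule bexI[of _ "- x"]) (simp_all add: complex_ring_def)
  qed (simp_all add: complex_ring_def)
  show "comm_monoid complex_ring"
    by (rule comm_monoidI) (simp_all add: complex_ring_def)
qed (simp_all add: complex_ring_def algebra_simps)

lemma ring_complex_cstar: "ring complex_cstar"
proof (rule ringI)
  show "abelian_group complex_cstar"
  proof (rule abelian_groupI)
    fix x assume "x \<in> carrier complex_cstar"
    show "\<exists>y\<in>carrier complex_cstar. y \<oplus>\<^bsub>complex_cstar\<^esub> x = \<zero>\<^bsub>complex_cstar\<^esub>"
      by (rule bexI[of _ "- x"]) (simp_all add: complex_cstar_sel)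
  qed (simp_all add: complex_cstar_sel)
  show "Group.monoid complex_cstar"
    by (rule monoidI) (simp_all add: complex_cstar_sel)
qed (simp_all add: complex_cstar_sel algebra_simps)

lemma complex_cstar_minus: "x \<ominus>\<^bsub>complex_cstar\<^esub> y = x - y"
proof -
  interpret ring complex_cstar by (rule ring_complex_cstar)
  have "\<ominus>\<^bsub>complex_cstar\<^esub> y = - y"
    by (rule minus_equality) (simp_all add: complex_cstar_sel)
  then show ?thesis by (simp add: a_minus_def complex_cstar_sel)
qed

lemma unital_cstar_algebra_complex: "unital_cstar_algebra complex_cstar"
proof (rule unital_cstar_algebra.intro)
  show "module complex_ring complex_cstar"
    by (rule moduleI[OF cring_complex_ring ring.is_abelian_group[OF ring_complex_cstar]])
      (simp_all add: complex_cstar_sel complex_ring_def algebra_simps)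
next
  fix s :: "nat \<Rightarrow> complex"
  assume "\<And>e. e > 0 \<Longrightarrow>
    \<exists>N. \<forall>m\<ge>N. \<forall>n\<ge>N. cnorm complex_cstar (s m \<ominus>\<^bsub>complex_cstar\<^esub> s n) < e"
  then have "Cauchy s"
    by (intro CauchyI) (simp add: complex_cstar_minus complex_cstar_sel)
  then obtain l where "s \<longlonglongrightarrow> l"
    using Cauchy_convergent convergent_def by blast
  then show "\<exists>l\<in>carrier complex_cstar.
      (\<lambda>n. cnorm complex_cstar (s n \<ominus>\<^bsub>complex_cstar\<^esub> l)) \<longlonglongrightarrow> 0"
    by (intro bexI[of _ l])
      (auto simp: complex_cstar_minus complex_cstar_sel intro: tendsto_norm_zero LIM_zero)
qed (auto simp: complex_cstar_sel algebra_simps norm_mult norm_triangle_ineq power2_eq_square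
      ring_complex_cstar)

lemma fun_cstar_sel:
  "carrier (fun_cstar X B) = topspace X \<rightarrow>\<^sub>E carrier B"
  "F \<otimes>\<^bsub>fun_cstar X B\<^esub> G = (\<lambda>x\<in>topspace X. F x \<otimes>\<^bsub>B\<^esub> G x)"
  "\<one>\<^bsub>fun_cstar X B\<^esub> = (\<lambda>x\<in>topspace X. \<one>\<^bsub>B\<^esub>)"
  "\<zero>\<^bsub>fun_cstar X B\<^esub> = (\<lambda>x\<in>topspace X. \<zero>\<^bsub>B\<^esub>)"
  "F \<oplus>\<^bsub>fun_cstar X B\<^esub> G = (\<lambda>x\<in>topspace X. F x \<oplus>\<^bsub>B\<^esub> G x)"
  "c \<odot>\<^bsub>fun_cstar X B\<^esub> F = (\<lambda>x\<in>topspace X. c \<odot>\<^bsub>B\<^esub> F x)"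
  "star (fun_cstar X B) F = (\<lambda>x\<in>topspace X. star B (F x))"
  "cnorm (fun_cstar X B) F = (SUP x\<in>topspace X. cnorm B (F x))"
  by (simp_all add: fun_cstar_def)

lemma cont_cstar_sel:
  "carrier (cont_cstar X) = {a \<in> extensional (topspace X). continuous_map X euclidean a}"
  "a \<otimes>\<^bsub>cont_cstar X\<^esub> b = (\<lambda>x\<in>topspace X. a x * b x)"
  "\<one>\<^bsub>cont_cstar X\<^esub> = (\<lambda>x\<in>topspace X. 1)"
  "\<zero>\<^bsub>cont_cstar X\<^esub> = (\<lambda>x\<in>topspace X. 0)"
  "a \<oplus>\<^bsub>cont_cstar X\<^esub> b = (\<lambda>x\<in>topspace X. a x + b x)"
  "c \<odot>\<^bsub>cont_cstar X\<^esub> a = (\<lambda>x\<in>topspace X. c * a x)"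
  "star (cont_cstar X) a = (\<lambda>x\<in>topspace X. cnj (a x))"
  "cnorm (cont_cstar X) a = (SUP x\<in>topspace X. cmod (a x))"
  by (simp_all add: cont_cstar_def fun_cstar_def complex_cstar_sel)

lemma continuous_map_complex_ops:
  fixes a b :: "'x \<Rightarrow> complex"
  assumes "continuous_map X euclidean a" "continuous_map X euclidean b"
  shows "continuous_map X euclidean (\<lambda>x. a x + b x)"
    and "continuous_map X euclidean (\<lambda>x. a x * b x)"
    and "continuous_map X euclidean (\<lambda>x. c * a x)"
    and "continuous_map X euclidean (\<lambda>x. cnj (a x))"
    and "continuous_map X euclidean (\<lambda>x. c)"
  using assms by (auto simp: continuous_map_atin intro!: tendsto_intros)

lemma continuous_map_bdd_above_cmod:
  assumes "compact_space X" "continuous_map X euclidean (a :: 'x \<Rightarrow> complex)"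
  shows "bdd_above ((\<lambda>x. cmod (a x)) ` topspace X)"
proof -
  have "compact (a ` topspace X)"
    using image_compactin[of X "topspace X" euclidean a] assms by (simp add: compact_space_def)
  then have "bounded (a ` topspace X)" by (rule compact_imp_bounded)
  then show ?thesis by (auto simp: bounded_iff bdd_above_def)
qed

lemma unital_cstar_algebra_cont:
  assumes "compact_space X" "topspace X \<noteq> {}"
  shows "unital_cstar_algebra (cont_cstar X)"
  unfolding cont_cstar_def
proof (rule unital_cstar_algebra.fun_cstar_subalgebra(1)[OF unital_cstar_algebra_complex assms(2)],
    goal_cases)
  case 1
  then show ?case by (auto simp: complex_cstar_sel PiE_def)
next
  case (7 F)
  then show ?case using continuous_map_bdd_above_cmod[OF assms(1), of F]
    by (simp add: complex_cstar_sel)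
next
  case (8 F)
  have "\<exists>G. continuous_map X euclidean G \<and> (\<forall>x\<in>topspace X. cmod (F x - G x) < e)"
    if "e > 0" for e
    using 8(2)[OF that] by (auto simp: complex_cstar_sel complex_cstar_minus)
  then obtain G where G: "\<And>e. e > 0 \<Longrightarrow> continuous_map X euclidean (G e)"
    "\<And>e x. e > 0 \<Longrightarrow> x \<in> topspace X \<Longrightarrow> cmod (F x - G e x) < e" by metis
  have "continuous_map X Met_TC.mtopology F"
  proof (rule Met_TC.continuous_map_uniform_limit[where F = "at_right 0" and f = G])
    show "\<forall>\<^sub>F e in at_right 0. continuous_map X Met_TC.mtopology (G e)"
      using G(1) by (auto simp: eventually_at_right_field mtopology_is_euclidean intro: exI[of _ 1])
    show "\<forall>\<^sub>F e in at_right 0. \<forall>x\<in>topspace X. F x \<in> UNIV \<and> dist (G e x) (F x) < \<epsilon>" if "0 < \<epsilon>" for \<epsilon>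
      unfolding eventually_at_right_field
      by (rule exI[of _ \<epsilon>])
        (use that G(2) in \<open>force simp: dist_norm norm_minus_commute intro: less_trans\<close>)
  qed auto
  then show ?case using 8(1) by (auto simp: PiE_def mtopology_is_euclidean)
qed (auto simp: fun_cstar_sel complex_cstar_sel intro: continuous_map_complex_ops)


subsection \<open>The tensor product\<close>

lemma cont_tensor_sel:
  "F \<otimes>\<^bsub>cont_tensor X B\<^esub> G = (\<lambda>x\<in>topspace X. F x \<otimes>\<^bsub>B\<^esub> G x)"
  "\<one>\<^bsub>cont_tensor X B\<^esub> = (\<lambda>x\<in>topspace X. \<one>\<^bsub>B\<^esub>)"
  "\<zero>\<^bsub>cont_tensor X B\<^esub> = (\<lambda>x\<in>topspace X. \<zero>\<^bsub>B\<^esub>)"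
  "F \<oplus>\<^bsub>cont_tensor X B\<^esub> G = (\<lambda>x\<in>topspace X. F x \<oplus>\<^bsub>B\<^esub> G x)"
  "c \<odot>\<^bsub>cont_tensor X B\<^esub> F = (\<lambda>x\<in>topspace X. c \<odot>\<^bsub>B\<^esub> F x)"
  "star (cont_tensor X B) F = (\<lambda>x\<in>topspace X. star B (F x))"
  "cnorm (cont_tensor X B) F = (SUP x\<in>topspace X. cnorm B (F x))"
  by (simp_all add: cont_tensor_def fun_cstar_def)

context unital_cstar_algebra
begin

context
  fixes X :: "'x topology"
  assumes compact: "compact_space X" and nonempty: "topspace X \<noteq> {}"
begin

abbreviation (input) "W \<equiv> tensor_span (cont_cstar X) A (fun_cstar X A) (elem_tensor X A)"
abbreviation (input) "S \<equiv> carrier (cont_tensor X A)"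

lemma W_mem: "F \<in> W \<Longrightarrow> F \<in> topspace X \<rightarrow>\<^sub>E carrier A"
proof (induction rule: tensor_span.induct)
  case (add p a b)
  have "p x \<in> carrier A" if "x \<in> topspace X" for x using add(4) that by auto
  then show ?case using add(3) by (auto simp: fun_cstar_sel elem_tensor_def)
qed (auto simp: fun_cstar_sel)

lemma W_mem': "F \<in> W \<Longrightarrow> x \<in> topspace X \<Longrightarrow> F x \<in> carrier A"
  using W_mem by auto

lemma S_iff: "F \<in> S \<longleftrightarrow> F \<in> topspace X \<rightarrow>\<^sub>E carrier A \<and>
   (\<forall>e>0. \<exists>G\<in>W. \<forall>x\<in>topspace X. cnorm A (F x \<ominus> G x) < e)"
  by (simp add: cont_tensor_def)

lemma S_mem: "F \<in> S \<Longrightarrow> x \<in> topspace X \<Longrightarrow> F x \<in> carrier A"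
  by (auto simp: S_iff)

lemma W_S: "F \<in> W \<Longrightarrow> F \<in> S"
  using W_mem[of F] W_mem'[of F] by (auto simp: S_iff a_minus_def Q.r_neg intro!: bexI[of _ F])

lemma W_bdd: "F \<in> W \<Longrightarrow> \<exists>C. \<forall>x\<in>topspace X. cnorm A (F x) \<le> C"
proof (induction rule: tensor_span.induct)
  case (add p a b)
  from add obtain C where C: "\<And>x. x \<in> topspace X \<Longrightarrow> cnorm A (p x) \<le> C" by blast
  obtain D where D: "\<And>x. x \<in> topspace X \<Longrightarrow> cmod (a x) \<le> D"
    using continuous_map_bdd_above_cmod[OF compact, of a] add(2)
    by (auto simp: cont_cstar_sel bdd_above_def)
  have "cnorm A (p x \<oplus> a x \<odot> b) \<le> C + D * cnorm A b" if x: "x \<in> topspace X" for x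
  proof -
    have "cnorm A (p x \<oplus> a x \<odot> b) \<le> cnorm A (p x) + cmod (a x) * cnorm A b"
      using cnorm_add[of "p x" "a x \<odot> b"] W_mem'[OF add(1) x] add(3) by (simp add: cnorm_smult)
    also have "\<dots> \<le> C + D * cnorm A b"
      using C[OF x] D[OF x] add(3) by (intro add_mono mult_right_mono) auto
    finally show ?thesis .
  qed
  then show ?case by (auto simp: fun_cstar_sel elem_tensor_def)
qed (auto simp: fun_cstar_sel)

lemma W_eqI:
  assumes "F \<in> W" "G \<in> topspace X \<rightarrow>\<^sub>E carrier A" "\<And>x. x \<in> topspace X \<Longrightarrow> F x = G x"
  shows "G \<in> W"
proof -
  have "F = G"
    using W_mem[OF assms(1)] assms(2,3) by (intro extensionalityI[of _ "topspace X"]) (auto simp: PiE_def)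
  then show ?thesis using assms(1) by simp
qed

lemma W_add:
  assumes F: "F \<in> W" and "G \<in> W"
  shows "(\<lambda>x\<in>topspace X. F x \<oplus> G x) \<in> W"
  using assms(2)
proof (induction rule: tensor_span.induct)
  case zero
  show ?case by (rule W_eqI[OF F]) (use W_mem'[OF F] in \<open>auto simp: fun_cstar_sel\<close>)
next
  case (add p a b)
  show ?case
    by (rule W_eqI[OF tensor_span.add[OF add(4) add(2) add(3)]])
      (use W_mem'[OF F] W_mem'[OF add(1)] add(3) in
        \<open>auto simp: fun_cstar_sel elem_tensor_def Q.a_assoc\<close>)
qed

lemma W_elem: "a \<in> carrier (cont_cstar X) \<Longrightarrow> b \<in> carrier A \<Longrightarrow> elem_tensor X A a b \<in> W"
  by (rule W_eqI[OF tensor_span.add[OF tensor_span.zero]])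
    (auto simp: fun_cstar_sel elem_tensor_def)

lemma W_one: "(\<lambda>x\<in>topspace X. \<one>) \<in> W"
proof -
  have "(\<lambda>x\<in>topspace X. 1) \<in> carrier (cont_cstar X)"
    by (simp add: cont_cstar_sel)
  from W_elem[OF this Q.one_closed] show ?thesis
    by (rule W_eqI) (auto simp: elem_tensor_def)
qed

lemma cont_mult_mem:
  "\<lbrakk>a \<in> carrier (cont_cstar X); b \<in> carrier (cont_cstar X)\<rbrakk> \<Longrightarrow>
    (\<lambda>x\<in>topspace X. a x * b x) \<in> carrier (cont_cstar X)"
  by (auto simp: cont_cstar_sel intro: continuous_map_complex_ops)

lemma cont_cnj_mem:
  "a \<in> carrier (cont_cstar X) \<Longrightarrow> (\<lambda>x\<in>topspace X. cnj (a x)) \<in> carrier (cont_cstar X)"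
  by (auto simp: cont_cstar_sel intro: continuous_map_complex_ops)

lemma W_smult:
  assumes "G \<in> W"
  shows "(\<lambda>x\<in>topspace X. c \<odot> G x) \<in> W"
  using assms
proof (induction rule: tensor_span.induct)
  case zero
  show ?case by (rule W_eqI[OF tensor_span.zero]) (auto simp: fun_cstar_sel)
next
  case (add p a b)
  show ?case
    by (rule W_eqI[OF tensor_span.add[OF add(4) add(2) smult_cl[OF add(3), of c]]])
      (use W_mem'[OF add(1)] add(3) in
        \<open>auto simp: fun_cstar_sel elem_tensor_def smult_add_r mult.commute simp flip: smult_smult\<close>)
qed

lemma W_star:
  assumes "G \<in> W"
  shows "(\<lambda>x\<in>topspace X. star A (G x)) \<in> W"
  using assms
proof (induction rule: tensor_span.induct)
  case zero
  show ?case by (rule W_eqI[OF tensor_span.zero]) (auto simp: fun_cstar_sel)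
next
  case (add p a b)
  show ?case
    by (rule W_eqI[OF tensor_span.add[OF add(4) cont_cnj_mem[OF add(2)] star_closed[OF add(3)]]])
      (use W_mem'[OF add(1)] add(3) in
        \<open>auto simp: fun_cstar_sel elem_tensor_def star_add star_smult star_closed\<close>)
qed

lemma W_mult_elem:
  assumes "G \<in> W" and a: "a \<in> carrier (cont_cstar X)" and b: "b \<in> carrier A"
  shows "(\<lambda>x\<in>topspace X. G x \<otimes> (a x \<odot> b)) \<in> W"
  using assms(1)
proof (induction rule: tensor_span.induct)
  case zero
  show ?case by (rule W_eqI[OF tensor_span.zero]) (use b in \<open>auto simp: fun_cstar_sel\<close>)
next
  case (add p a' b')
  show ?case
    by (rule W_eqI[OF tensor_span.add[OF add(4) cont_mult_mem[OF add(2) a] Q.m_closed[OF add(3) b]]])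
      (use W_mem'[OF add(1)] add(3) b in \<open>auto simp: fun_cstar_sel elem_tensor_def Q.l_distr
        smult_mult_left smult_mult_right smult_add_r mult.commute simp flip: smult_smult\<close>)
qed

lemma W_mult:
  assumes F: "F \<in> W" and "G \<in> W"
  shows "(\<lambda>x\<in>topspace X. F x \<otimes> G x) \<in> W"
  using assms(2)
proof (induction rule: tensor_span.induct)
  case zero
  show ?case by (rule W_eqI[OF tensor_span.zero])
     (use W_mem'[OF F] in \<open>auto simp: fun_cstar_sel\<close>)
next
  case (add p a b)
  show ?case
    by (rule W_eqI[OF W_add[OF add(4) W_mult_elem[OF F add(2) add(3)]]])
      (use W_mem'[OF F] W_mem'[OF add(1)] add(3) in
        \<open>auto simp: fun_cstar_sel elem_tensor_def Q.r_distr\<close>)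
qed

lemma S_bdd:
  assumes F: "F \<in> S"
  obtains C where "C > 0" "\<And>x. x \<in> topspace X \<Longrightarrow> cnorm A (F x) \<le> C"
proof -
  obtain G where G: "G \<in> W" "\<And>x. x \<in> topspace X \<Longrightarrow> cnorm A (F x \<ominus> G x) < 1"
    using F[unfolded S_iff, THEN conjunct2, rule_format, of 1] by auto
  obtain C where C: "\<And>x. x \<in> topspace X \<Longrightarrow> cnorm A (G x) \<le> C" using W_bdd[OF G(1)] by blast
  have "cnorm A (F x) \<le> 1 + \<bar>C\<bar>" if x: "x \<in> topspace X" for x
    using cnorm_le_diff[OF S_mem[OF F x] W_mem'[OF G(1) x]] G(2)[OF x] C[OF x] by linarith
  then show ?thesis using that[of "1 + \<bar>C\<bar>"] by simp
qed

lemma S_app: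
  assumes F: "F \<in> S" and e: "e > 0"
  obtains G where "G \<in> W" "\<And>x. x \<in> topspace X \<Longrightarrow> cnorm A (F x \<ominus> G x) < e"
  using F[unfolded S_iff, THEN conjunct2, rule_format, OF e] by auto

lemma S_add:
  assumes F: "F \<in> S" and G: "G \<in> S"
  shows "(\<lambda>x\<in>topspace X. F x \<oplus> G x) \<in> S"
  unfolding S_iff
proof (intro conjI allI impI)
  show "(\<lambda>x\<in>topspace X. F x \<oplus> G x) \<in> topspace X \<rightarrow>\<^sub>E carrier A"
    using S_mem[OF F] S_mem[OF G] by auto
  fix e :: real assume e: "e > 0"
  obtain F' where F': "F' \<in> W" "\<And>x. x \<in> topspace X \<Longrightarrow> cnorm A (F x \<ominus> F' x) < e/2"
    using S_app[OF F, of "e/2"] e by auto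
  obtain G' where G': "G' \<in> W" "\<And>x. x \<in> topspace X \<Longrightarrow> cnorm A (G x \<ominus> G' x) < e/2"
    using S_app[OF G, of "e/2"] e by auto
  have "cnorm A ((F x \<oplus> G x) \<ominus> (F' x \<oplus> G' x)) < e" if x: "x \<in> topspace X" for x
    using diff_add[OF S_mem[OF F x] W_mem'[OF F'(1) x] S_mem[OF G x] W_mem'[OF G'(1) x]]
      F'(2)[OF x] G'(2)[OF x] by linarith
  then show "\<exists>H\<in>W. \<forall>x\<in>topspace X. cnorm A ((\<lambda>x\<in>topspace X. F x \<oplus> G x) x \<ominus> H x) < e"
    using W_add[OF F'(1) G'(1)] by (intro bexI) auto
qed

lemma S_smult:
  assumes F: "F \<in> S"
  shows "(\<lambda>x\<in>topspace X. c \<odot> F x) \<in> S"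
  unfolding S_iff
proof (intro conjI allI impI)
  show "(\<lambda>x\<in>topspace X. c \<odot> F x) \<in> topspace X \<rightarrow>\<^sub>E carrier A"
    using S_mem[OF F] by auto
  fix e :: real assume e: "e > 0"
  define d where "d = e / (cmod c + 1)"
  have d: "d > 0" using e by (simp add: d_def add_nonneg_pos)
  obtain F' where F': "F' \<in> W" "\<And>x. x \<in> topspace X \<Longrightarrow> cnorm A (F x \<ominus> F' x) < d"
    using S_app[OF F d] by auto
  have "cnorm A (c \<odot> F x \<ominus> c \<odot> F' x) < e" if x: "x \<in> topspace X" for x
  proof -
    have "cmod c * cnorm A (F x \<ominus> F' x) \<le> cmod c * d"
      using F'(2)[OF x] by (intro mult_left_mono) auto
    also have "\<dots> < (cmod c + 1) * d" using d by simp
    also have "\<dots> = e" using norm_ge_zero[of c] by (simp add: d_def add_nonneg_eq_0_iff)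
    finally show ?thesis by (simp add: diff_smult S_mem[OF F x] W_mem'[OF F'(1) x])
  qed
  then show "\<exists>H\<in>W. \<forall>x\<in>topspace X. cnorm A ((\<lambda>x\<in>topspace X. c \<odot> F x) x \<ominus> H x) < e"
    using W_smult[OF F'(1), of c] by (intro bexI) auto
qed

lemma S_star:
  assumes F: "F \<in> S"
  shows "(\<lambda>x\<in>topspace X. star A (F x)) \<in> S"
  unfolding S_iff
proof (intro conjI allI impI)
  show "(\<lambda>x\<in>topspace X. star A (F x)) \<in> topspace X \<rightarrow>\<^sub>E carrier A"
    using S_mem[OF F] by (auto simp: star_closed)
  fix e :: real assume e: "e > 0"
  obtain F' where F': "F' \<in> W" "\<And>x. x \<in> topspace X \<Longrightarrow> cnorm A (F x \<ominus> F' x) < e"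
    using S_app[OF F e] by auto
  have "cnorm A (star A (F x) \<ominus> star A (F' x)) < e" if x: "x \<in> topspace X" for x
    using F'(2)[OF x] by (simp add: diff_star S_mem[OF F x] W_mem'[OF F'(1) x])
  then show "\<exists>H\<in>W. \<forall>x\<in>topspace X. cnorm A ((\<lambda>x\<in>topspace X. star A (F x)) x \<ominus> H x) < e"
    using W_star[OF F'(1)] by (intro bexI) auto
qed

lemma S_mult:
  assumes F: "F \<in> S" and G: "G \<in> S"
  shows "(\<lambda>x\<in>topspace X. F x \<otimes> G x) \<in> S"
  unfolding S_iff
proof (intro conjI allI impI)
  show "(\<lambda>x\<in>topspace X. F x \<otimes> G x) \<in> topspace X \<rightarrow>\<^sub>E carrier A"
    using S_mem[OF F] S_mem[OF G] by auto
  fix e :: real assume e: "e > 0"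
  obtain D where D: "D > 0" "\<And>x. x \<in> topspace X \<Longrightarrow> cnorm A (G x) \<le> D"
    using S_bdd[OF G] by blast
  obtain F' where F': "F' \<in> W" "\<And>x. x \<in> topspace X \<Longrightarrow> cnorm A (F x \<ominus> F' x) < e / (2 * D)"
    using S_app[OF F, of "e / (2 * D)"] e D(1) by auto
  obtain C where C: "C > 0" "\<And>x. x \<in> topspace X \<Longrightarrow> cnorm A (F' x) \<le> C"
    using S_bdd[OF W_S[OF F'(1)]] by blast
  obtain G' where G': "G' \<in> W" "\<And>x. x \<in> topspace X \<Longrightarrow> cnorm A (G x \<ominus> G' x) < e / (2 * C)"
    using S_app[OF G, of "e / (2 * C)"] e C(1) by auto
  have "cnorm A ((F x \<otimes> G x) \<ominus> (F' x \<otimes> G' x)) < e" if x: "x \<in> topspace X" for x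
  proof -
    note m = S_mem[OF F x] W_mem'[OF F'(1) x] S_mem[OF G x] W_mem'[OF G'(1) x]
    have "cnorm A (F x \<ominus> F' x) * cnorm A (G x) \<le> cnorm A (F x \<ominus> F' x) * D"
      using D(2)[OF x] m by (intro mult_left_mono) auto
    also have "\<dots> < e / (2 * D) * D" using F'(2)[OF x] D(1) by (intro mult_strict_right_mono)
    finally have 1: "cnorm A (F x \<ominus> F' x) * cnorm A (G x) < e / 2" using D(1) by simp
    have "cnorm A (F' x) * cnorm A (G x \<ominus> G' x) \<le> C * cnorm A (G x \<ominus> G' x)"
      using C(2)[OF x] m by (intro mult_right_mono) auto
    also have "\<dots> < C * (e / (2 * C))" using G'(2)[OF x] C(1) by (intro mult_strict_left_mono)
    finally have 2: "cnorm A (F' x) * cnorm A (G x \<ominus> G' x) < e / 2" using C(1) by simp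
    show ?thesis using diff_mult[OF m] 1 2 by linarith
  qed
  then show "\<exists>H\<in>W. \<forall>x\<in>topspace X. cnorm A ((\<lambda>x\<in>topspace X. F x \<otimes> G x) x \<ominus> H x) < e"
    using W_mult[OF F'(1) G'(1)] by (intro bexI) auto
qed

lemma S_closed:
  assumes F: "F \<in> topspace X \<rightarrow>\<^sub>E carrier A"
    and app: "\<And>e. e > 0 \<Longrightarrow> \<exists>G\<in>S. \<forall>x\<in>topspace X. cnorm A (F x \<ominus> G x) < e"
  shows "F \<in> S"
  unfolding S_iff
proof (intro conjI allI impI F)
  fix e :: real assume e: "e > 0"
  obtain G where G: "G \<in> S" "\<And>x. x \<in> topspace X \<Longrightarrow> cnorm A (F x \<ominus> G x) < e/2"
    using app[of "e/2"] e by auto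
  obtain G' where G': "G' \<in> W" "\<And>x. x \<in> topspace X \<Longrightarrow> cnorm A (G x \<ominus> G' x) < e/2"
    using S_app[OF G(1), of "e/2"] e by auto
  have "cnorm A (F x \<ominus> G' x) < e" if x: "x \<in> topspace X" for x
  proof -
    have "F x \<in> carrier A" using F x by auto
    from diff_triangle[OF this S_mem[OF G(1) x] W_mem'[OF G'(1) x]] show ?thesis
      using G(2)[OF x] G'(2)[OF x] by linarith
  qed
  then show "\<exists>G\<in>W. \<forall>x\<in>topspace X. cnorm A (F x \<ominus> G x) < e" using G'(1) by blast
qed

lemma S_bdd_above: "F \<in> S \<Longrightarrow> bdd_above ((\<lambda>x. cnorm A (F x)) ` topspace X)"
  by (rule S_bdd[of F]) (auto simp: bdd_above_def)

lemma cont_tensor_eq: "cont_tensor X A = fun_cstar X A\<lparr>carrier := S\<rparr>"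
  by (simp add: cont_tensor_def)

lemma unital_cstar_algebra_cont_tensor: "unital_cstar_algebra (cont_tensor X A)"
  and cont_tensor_minus: "\<lbrakk>F \<in> S; G \<in> S\<rbrakk> \<Longrightarrow>
    F \<ominus>\<^bsub>cont_tensor X A\<^esub> G = (\<lambda>x\<in>topspace X. F x \<ominus> G x)"
proof -
  have "S \<subseteq> topspace X \<rightarrow>\<^sub>E carrier A" by (auto simp: S_iff)
  note * = fun_cstar_subalgebra[OF nonempty this, folded cont_tensor_eq, unfolded cont_tensor_sel,
      OF W_S[OF W_one] S_add S_mult S_smult S_star S_bdd_above S_closed]
  show "unital_cstar_algebra (cont_tensor X A)" by (rule *(1))
  show "\<lbrakk>F \<in> S; G \<in> S\<rbrakk> \<Longrightarrow> F \<ominus>\<^bsub>cont_tensor X A\<^esub> G = (\<lambda>x\<in>topspace X. F x \<ominus> G x)"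
    by (rule *(2))
qed

end

end

lemma (in unital_cstar_algebra) finsum_cont_tensor_apply:
  fixes X :: "'x topology"
  assumes X: "compact_space X" "topspace X \<noteq> {}" and x: "x \<in> topspace X"
    and F: "F \<in> {..<n::nat} \<rightarrow> carrier (cont_tensor X A)"
  shows "finsum (cont_tensor X A) F {..<n} x = finsum A (\<lambda>k. F k x) {..<n}"
proof -
  interpret P: unital_cstar_algebra "cont_tensor X A"
    by (rule unital_cstar_algebra_cont_tensor[OF X])
  show ?thesis
    using F
  proof (induction n)
    case 0
    then show ?case using x by (simp add: cont_tensor_sel)
  next
    case (Suc n)
    have F: "F \<in> {..<n} \<rightarrow> carrier (cont_tensor X A)" "F n \<in> carrier (cont_tensor X A)"
      using Suc.prems by auto
    then have F': "(\<lambda>k. F k x) \<in> {..<n} \<rightarrow> carrier A" "F n x \<in> carrier A"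
      using S_mem[OF X _ x] by auto
    show ?case
      using Suc.IH[OF F(1)] F F' x
      by (simp add: lessThan_Suc P.Q.finsum_insert Q.finsum_insert cont_tensor_sel)
  qed
qed

theorem is_cstar_tensor_product_cont_tensor:
  fixes X :: "'x topology"
  assumes X: "compact_space X" "topspace X \<noteq> {}" and B: "unital_cstar_algebra B"
  shows "is_cstar_tensor_product (cont_cstar X) B (cont_tensor X B) (elem_tensor X B)"
proof -
  interpret B: unital_cstar_algebra B by (rule B)
  let ?P = "cont_tensor X B"
  interpret P: unital_cstar_algebra ?P by (rule B.unital_cstar_algebra_cont_tensor[OF X])
  have elem: "elem_tensor X B a b \<in> carrier ?P" if "a \<in> carrier (cont_cstar X)" "b \<in> carrier B" for a b
    using B.W_S[OF X B.W_elem[OF X that]] .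
  have indep: "a k = \<zero>\<^bsub>cont_cstar X\<^esub>"
    if a: "a \<in> {..<n} \<rightarrow> carrier (cont_cstar X)" and b: "b \<in> {..<n} \<rightarrow> carrier B"
      and ind: "\<And>c. finsum B (\<lambda>k. c k \<odot>\<^bsub>B\<^esub> b k) {..<n} = \<zero>\<^bsub>B\<^esub> \<Longrightarrow> \<forall>k<n. c k = 0"
      and 0: "finsum ?P (\<lambda>k. elem_tensor X B (a k) (b k)) {..<n} = \<zero>\<^bsub>?P\<^esub>" and k: "k < n"
    for n :: nat and a b k
  proof -
    have "a k x = 0" if x: "x \<in> topspace X" for x
    proof -
      have "finsum B (\<lambda>k. elem_tensor X B (a k) (b k) x) {..<n} = \<zero>\<^bsub>?P\<^esub> x"
        using B.finsum_cont_tensor_apply[OF X x, of "\<lambda>k. elem_tensor X B (a k) (b k)" n] a b 0 elem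
        by (simp add: Pi_iff)
      then have "finsum B (\<lambda>k. a k x \<odot>\<^bsub>B\<^esub> b k) {..<n} = \<zero>\<^bsub>B\<^esub>"
        using x by (simp add: elem_tensor_def cont_tensor_sel)
      from ind[OF this] k show ?thesis by blast
    qed
    then show ?thesis
      using a k by (intro extensionalityI[of _ "topspace X"]) (auto simp: cont_cstar_sel)
  qed
  have z: "\<zero>\<^bsub>?P\<^esub> = \<zero>\<^bsub>fun_cstar X B\<^esub>" and p: "p \<oplus>\<^bsub>?P\<^esub> q = p \<oplus>\<^bsub>fun_cstar X B\<^esub> q" for p q
    by (simp_all only: fun_cstar_sel cont_tensor_sel)
  have span: "tensor_span (cont_cstar X) B ?P (elem_tensor X B) =
      tensor_span (cont_cstar X) B (fun_cstar X B) (elem_tensor X B)" (is "?V = ?W")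
  proof (intro equalityI subsetI)
    show "p \<in> ?W" if "p \<in> ?V" for p using that
    proof induction
      case zero
      show ?case unfolding z by (rule tensor_span.zero)
    next
      case (add p a b)
      show ?case unfolding p by (rule tensor_span.add[OF add(4,2,3)])
    qed
    show "p \<in> ?V" if "p \<in> ?W" for p using that
    proof induction
      case zero
      show ?case unfolding z[symmetric] by (rule tensor_span.zero)
    next
      case (add p a b)
      show ?case unfolding p[symmetric] by (rule tensor_span.add[OF add(4,2,3)])
    qed
  qed
  have dense: "\<exists>q\<in>?V. cnorm ?P (p \<ominus>\<^bsub>?P\<^esub> q) < e" if p: "p \<in> carrier ?P" and e: "e > 0" for p and e :: real
  proof -
    from e have "e / 2 > 0" by simp
    from B.S_app[OF X p this] obtain q where q: "q \<in> ?W"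
      "\<And>x. x \<in> topspace X \<Longrightarrow> cnorm B (p x \<ominus>\<^bsub>B\<^esub> q x) < e / 2" by blast
    have "cnorm ?P (p \<ominus>\<^bsub>?P\<^esub> q) \<le> e / 2"
      unfolding B.cont_tensor_minus[OF X p B.W_S[OF X q(1)]] cont_tensor_sel
      using X(2) by (intro cSUP_least) (use q(2) in \<open>auto dest: less_imp_le\<close>)
    then show ?thesis using q(1) e unfolding span by (intro bexI[of _ q]) auto
  qed
  show ?thesis
    unfolding is_cstar_tensor_product_def
  proof (intro conjI ballI allI impI)
    show "unital_cstar_algebra (cont_cstar X)" by (rule unital_cstar_algebra_cont[OF X])
    show "unital_cstar_algebra ?P" by (rule P.unital_cstar_algebra_axioms)
    show "a k = \<zero>\<^bsub>cont_cstar X\<^esub>"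
      if "a \<in> {..<n} \<rightarrow> carrier (cont_cstar X) \<and> b \<in> {..<n} \<rightarrow> carrier B \<and>
        (\<forall>c. finsum B (\<lambda>k. c k \<odot>\<^bsub>B\<^esub> b k) {..<n} = \<zero>\<^bsub>B\<^esub> \<longrightarrow> (\<forall>k<n. c k = 0)) \<and>
        finsum ?P (\<lambda>k. elem_tensor X B (a k) (b k)) {..<n} = \<zero>\<^bsub>?P\<^esub>" "k < n" for n :: nat and a b k
      using that by (intro indep[of a n b k]) auto
    have [simp]: "a x \<odot>\<^bsub>B\<^esub> b \<in> carrier B" if "b \<in> carrier B" for a :: "'x \<Rightarrow> complex" and b x
      using that by simp
    fix a assume a: "a \<in> carrier (cont_cstar X)"
    fix b assume b: "b \<in> carrier B"
    note simps = elem_tensor_def cont_tensor_sel cont_cstar_sel(2-)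
    show "elem_tensor X B (c \<odot>\<^bsub>cont_cstar X\<^esub> a) b = c \<odot>\<^bsub>?P\<^esub> elem_tensor X B a b" for c
      unfolding simps by (rule restrict_ext) (simp add: b B.smult_smult)
    show "elem_tensor X B a (c \<odot>\<^bsub>B\<^esub> b) = c \<odot>\<^bsub>?P\<^esub> elem_tensor X B a b" for c
      unfolding simps by (rule restrict_ext) (simp add: b mult.commute flip: B.smult_smult)
    show "elem_tensor X B (star (cont_cstar X) a) (star B b) = star ?P (elem_tensor X B a b)"
      unfolding simps by (rule restrict_ext) (simp add: b B.star_smult)
    show "elem_tensor X B a b \<in> carrier ?P" by (rule elem[OF a b])
    show "elem_tensor X B a (b \<oplus>\<^bsub>B\<^esub> b') = elem_tensor X B a b \<oplus>\<^bsub>?P\<^esub> elem_tensor X B a b'"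
      if "b' \<in> carrier B" for b'
      unfolding simps by (rule restrict_ext) (simp add: b that B.smult_add_r)
    fix a' assume a': "a' \<in> carrier (cont_cstar X)"
    show "elem_tensor X B (a \<oplus>\<^bsub>cont_cstar X\<^esub> a') b = elem_tensor X B a b \<oplus>\<^bsub>?P\<^esub> elem_tensor X B a' b"
      unfolding simps by (rule restrict_ext) (simp add: b B.smult_add_l)
    show "elem_tensor X B (a \<otimes>\<^bsub>cont_cstar X\<^esub> a') (b \<otimes>\<^bsub>B\<^esub> b') =
        elem_tensor X B a b \<otimes>\<^bsub>?P\<^esub> elem_tensor X B a' b'" if "b' \<in> carrier B" for b'
      unfolding simps by (rule restrict_ext)
        (simp add: b that B.smult_mult_left B.smult_mult_right B.smult_smult mult.commute)
  next
    show "elem_tensor X B \<one>\<^bsub>cont_cstar X\<^esub> \<one>\<^bsub>B\<^esub> = \<one>\<^bsub>?P\<^esub>"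
      unfolding elem_tensor_def cont_tensor_sel cont_cstar_sel(3) by (rule restrict_ext) simp
  qed (simp_all add: B dense)
qed


subsection \<open>Pullbacks of tensors\<close>

lemma pullback_tensor_elem:
  assumes "continuous_map X Y g"
  shows "pullback_tensor X g (elem_tensor Y B a b) = elem_tensor X B (pullback X g a) b"
  using continuous_map_funspace[OF assms]
  by (auto simp: pullback_tensor_def elem_tensor_def pullback_def intro!: restrict_ext)

lemma pullback_cont:
  assumes g: "continuous_map X Y g" and a: "a \<in> carrier (cont_cstar Y)"
  shows "pullback X g a \<in> carrier (cont_cstar X)"
  using a continuous_map_compose[OF g, of euclidean a]
  by (simp add: cont_cstar_sel pullback_def o_def)

theorem pullback_star_hom:
  assumes g: "continuous_map X Y g"
  shows "pullback X g \<in> unital_star_hom (cont_cstar Y) (cont_cstar X)"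
proof -
  have gX: "g x \<in> topspace Y" if "x \<in> topspace X" for x
    using continuous_map_funspace[OF g] that by auto
  have mem: "pullback X g \<in> carrier (cont_cstar Y) \<rightarrow> carrier (cont_cstar X)"
    using pullback_cont[OF g] by blast
  show ?thesis
    unfolding unital_star_hom_def ring_hom_def
    using mem gX by (auto simp: pullback_def cont_cstar_sel(2-) fun_eq_iff)
qed

theorem pullback_tensor_star_hom:
  fixes X :: "'x topology" and Y :: "'y topology"
  assumes B: "unital_cstar_algebra B"
    and X: "compact_space X" "topspace X \<noteq> {}" and Y: "compact_space Y" "topspace Y \<noteq> {}"
    and g: "continuous_map X Y g"
  shows "pullback_tensor X g \<in> unital_star_hom (cont_tensor Y B) (cont_tensor X B)"
proof -
  interpret B: unital_cstar_algebra B by (rule B)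
  have gX: "g x \<in> topspace Y" if "x \<in> topspace X" for x
    using continuous_map_funspace[OF g] that by auto
  have W: "pullback_tensor X g F \<in> tensor_span (cont_cstar X) B (fun_cstar X B) (elem_tensor X B)"
    if "F \<in> tensor_span (cont_cstar Y) B (fun_cstar Y B) (elem_tensor Y B)" for F
    using that
  proof induction
    case zero
    show ?case
      by (rule B.W_eqI[OF X tensor_span.zero]) (auto simp: fun_cstar_sel pullback_tensor_def gX)
  next
    case (add F a b)
    show ?case
      by (rule B.W_eqI[OF X tensor_span.add[OF add(4) pullback_cont[OF g add(2)] add(3)]])
        (use B.W_mem'[OF Y add(1)] add(3) in
          \<open>auto simp: fun_cstar_sel pullback_tensor_def pullback_def elem_tensor_def gX\<close>)
  qed
  have mem: "pullback_tensor X g F \<in> carrier (cont_tensor X B)" if F: "F \<in> carrier (cont_tensor Y B)" for F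
    unfolding B.S_iff[OF X]
  proof (intro conjI allI impI)
    show "pullback_tensor X g F \<in> topspace X \<rightarrow>\<^sub>E carrier B"
      using B.S_mem[OF Y F] gX by (auto simp: pullback_tensor_def)
    fix e :: real assume e: "e > 0"
    from B.S_app[OF Y F e] obtain G
      where G: "G \<in> tensor_span (cont_cstar Y) B (fun_cstar Y B) (elem_tensor Y B)"
        "\<And>y. y \<in> topspace Y \<Longrightarrow> cnorm B (F y \<ominus>\<^bsub>B\<^esub> G y) < e" by blast
    show "\<exists>G\<in>tensor_span (cont_cstar X) B (fun_cstar X B) (elem_tensor X B).
        \<forall>x\<in>topspace X. cnorm B (pullback_tensor X g F x \<ominus>\<^bsub>B\<^esub> G x) < e"
      by (rule bexI[OF _ W[OF G(1)]]) (use G(2) gX in \<open>auto simp: pullback_tensor_def\<close>)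
  qed
  show ?thesis
    using mem gX
    by (auto simp: unital_star_hom_def ring_hom_def pullback_tensor_def cont_tensor_sel fun_eq_iff)
qed

theorem pullback_tensor_unique:
  fixes X :: "'x topology" and Y :: "'y topology"
  assumes B: "unital_cstar_algebra B"
    and X: "compact_space X" "topspace X \<noteq> {}" and Y: "compact_space Y" "topspace Y \<noteq> {}"
    and g: "continuous_map X Y g"
    and \<Psi>: "\<Psi> \<in> unital_star_hom (cont_tensor Y B) (cont_tensor X B)"
    and contr: "\<And>F. F \<in> carrier (cont_tensor Y B) \<Longrightarrow>
      cnorm (cont_tensor X B) (\<Psi> F) \<le> cnorm (cont_tensor Y B) F"
    and elem: "\<And>a b. \<lbrakk>a \<in> carrier (cont_cstar Y); b \<in> carrier B\<rbrakk> \<Longrightarrow>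
      \<Psi> (elem_tensor Y B a b) = elem_tensor X B (pullback X g a) b"
    and F: "F \<in> carrier (cont_tensor Y B)"
  shows "\<Psi> F = pullback_tensor X g F"
proof -
  interpret B: unital_cstar_algebra B by (rule B)
  let ?P = "cont_tensor X B" and ?Q = "cont_tensor Y B"
  interpret P: unital_cstar_algebra ?P by (rule B.unital_cstar_algebra_cont_tensor[OF X])
  interpret Q: unital_cstar_algebra ?Q by (rule B.unital_cstar_algebra_cont_tensor[OF Y])
  let ?W = "tensor_span (cont_cstar Y) B (fun_cstar Y B) (elem_tensor Y B)"
  have gX: "g x \<in> topspace Y" if "x \<in> topspace X" for x
    using continuous_map_funspace[OF g] that by auto
  have \<Phi>: "pullback_tensor X g \<in> unital_star_hom ?Q ?P"
    by (rule pullback_tensor_star_hom[OF B X Y g])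
  have \<Psi>_mem: "\<Psi> G \<in> carrier ?P" if "G \<in> carrier ?Q" for G
    using \<Psi> that by (auto simp: unital_star_hom_def ring_hom_def)
  have \<Psi>_add: "\<Psi> (G \<oplus>\<^bsub>?Q\<^esub> H) = \<Psi> G \<oplus>\<^bsub>?P\<^esub> \<Psi> H" if "G \<in> carrier ?Q" "H \<in> carrier ?Q" for G H
    using \<Psi> that by (auto simp: unital_star_hom_def ring_hom_def)
  have \<Psi>_smult: "\<Psi> (c \<odot>\<^bsub>?Q\<^esub> G) = c \<odot>\<^bsub>?P\<^esub> \<Psi> G" if "G \<in> carrier ?Q" for c G
    using \<Psi> that by (auto simp: unital_star_hom_def)
  have \<Psi>_minus: "\<Psi> (G \<ominus>\<^bsub>?Q\<^esub> H) = \<Psi> G \<ominus>\<^bsub>?P\<^esub> \<Psi> H" if "G \<in> carrier ?Q" "H \<in> carrier ?Q" for G H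
    using that by (simp add: a_minus_def Q.minus_smult P.minus_smult \<Psi>_add \<Psi>_smult \<Psi>_mem)
  have \<Psi>_zero: "\<Psi> \<zero>\<^bsub>?Q\<^esub> = \<zero>\<^bsub>?P\<^esub>"
    using \<Psi>_smult[of "\<zero>\<^bsub>?Q\<^esub>" 0] \<Psi>_mem[of "\<zero>\<^bsub>?Q\<^esub>"] by simp
  have W: "\<Psi> G = pullback_tensor X g G" if "G \<in> ?W" for G
    using that
  proof induction
    case zero
    have "\<zero>\<^bsub>fun_cstar Y B\<^esub> = \<zero>\<^bsub>?Q\<^esub>" by (simp only: fun_cstar_sel cont_tensor_sel)
    then have "\<Psi> \<zero>\<^bsub>fun_cstar Y B\<^esub> = (\<lambda>x\<in>topspace X. \<zero>\<^bsub>B\<^esub>)"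
      using \<Psi>_zero by (simp only: cont_tensor_sel)
    moreover have "pullback_tensor X g \<zero>\<^bsub>fun_cstar Y B\<^esub> = (\<lambda>x\<in>topspace X. \<zero>\<^bsub>B\<^esub>)"
      unfolding pullback_tensor_def fun_cstar_sel by (rule restrict_ext) (simp add: gX)
    ultimately show ?case by simp
  next
    case (add G a b)
    have e: "elem_tensor Y B a b \<in> carrier ?Q" "G \<in> carrier ?Q"
      using B.W_S[OF Y B.W_elem[OF Y add(2,3)]] B.W_S[OF Y add(1)] by auto
    have *: "G \<oplus>\<^bsub>fun_cstar Y B\<^esub> elem_tensor Y B a b = G \<oplus>\<^bsub>?Q\<^esub> elem_tensor Y B a b"
      by (simp only: fun_cstar_sel cont_tensor_sel)
    have "pullback_tensor X g (G \<oplus>\<^bsub>?Q\<^esub> elem_tensor Y B a b) =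
        pullback_tensor X g G \<oplus>\<^bsub>?P\<^esub> pullback_tensor X g (elem_tensor Y B a b)"
      using \<Phi> e by (auto simp: unital_star_hom_def ring_hom_def)
    then show ?case
      unfolding * using \<Psi>_add[OF e(2,1)] add(4) elem[OF add(2,3)]
      by (simp add: pullback_tensor_elem[OF g])
  qed
  have le: "cnorm B (\<Psi> F x \<ominus>\<^bsub>B\<^esub> F (g x)) \<le> e" if x: "x \<in> topspace X" and e: "e > 0" for x e
  proof -
    from e have "e / 2 > 0" by simp
    from B.S_app[OF Y F this] obtain G where G: "G \<in> ?W"
      "\<And>y. y \<in> topspace Y \<Longrightarrow> cnorm B (F y \<ominus>\<^bsub>B\<^esub> G y) < e / 2" by blast
    note GS = B.W_S[OF Y G(1)]
    have FG: "F \<ominus>\<^bsub>?Q\<^esub> G \<in> carrier ?Q" by (rule Q.Q.minus_closed[OF F GS])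
    have "cnorm ?Q (F \<ominus>\<^bsub>?Q\<^esub> G) \<le> e / 2"
      unfolding B.cont_tensor_minus[OF Y F GS] cont_tensor_sel
      using Y(2) by (intro cSUP_least) (use G(2) in \<open>auto dest: less_imp_le\<close>)
    then have "cnorm ?P (\<Psi> F \<ominus>\<^bsub>?P\<^esub> \<Psi> G) \<le> e / 2"
      using contr[OF FG] by (simp add: \<Psi>_minus[OF F GS])
    moreover have "cnorm B ((\<Psi> F \<ominus>\<^bsub>?P\<^esub> \<Psi> G) x) \<le> cnorm ?P (\<Psi> F \<ominus>\<^bsub>?P\<^esub> \<Psi> G)"
      unfolding cont_tensor_sel
      by (rule cSUP_upper[OF x B.S_bdd_above[OF X]])
        (rule P.Q.minus_closed[OF \<Psi>_mem[OF F] \<Psi>_mem[OF GS]])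
    ultimately have 1: "cnorm B (\<Psi> F x \<ominus>\<^bsub>B\<^esub> \<Psi> G x) \<le> e / 2"
      using x by (simp add: B.cont_tensor_minus[OF X \<Psi>_mem[OF F] \<Psi>_mem[OF GS]])
    have 2: "\<Psi> G x = G (g x)" using x by (simp add: W[OF G(1)] pullback_tensor_def)
    note m = B.S_mem[OF X \<Psi>_mem[OF F] x] B.S_mem[OF Y GS gX[OF x]] B.S_mem[OF Y F gX[OF x]]
    show ?thesis
      using B.diff_triangle[OF m] 1[unfolded 2] G(2)[OF gX[OF x]] B.diff_commute[OF m(3,2)]
      by linarith
  qed
  show ?thesis
  proof (rule extensionalityI[of _ "topspace X"])
    show "\<Psi> F \<in> extensional (topspace X)"
      using \<Psi>_mem[OF F] by (auto simp: B.S_iff[OF X] PiE_def)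
    show "pullback_tensor X g F \<in> extensional (topspace X)" by (simp add: pullback_tensor_def)
    fix x assume x: "x \<in> topspace X"
    have "\<Psi> F x = F (g x)"
      using field_le_epsilon[of "cnorm B (\<Psi> F x \<ominus>\<^bsub>B\<^esub> F (g x))" 0] le[OF x]
      by (intro B.diff_eq_0 B.S_mem[OF X \<Psi>_mem[OF F] x] B.S_mem[OF Y F gX[OF x]]) simp
    then show "\<Psi> F x = pullback_tensor X g F x" using x by (simp add: pullback_tensor_def)
  qed
qed



subsection \<open>The operators on a finite-dimensional Hilbert space\<close>

lemma scaleC_one [simp]: "1 *\<^sub>C x = (x::'a::complex_euclidean_space)"
  using scaleC_of_real[of 1 x] by simp

lemma scaleC_zero_left [simp]: "0 *\<^sub>C x = (0::'a::complex_euclidean_space)"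
  using scaleC_of_real[of 0 x] by simp

lemma scaleC_scaleR: "c *\<^sub>C r *\<^sub>R x = r *\<^sub>R c *\<^sub>C (x::'a::complex_euclidean_space)"
  by (simp add: scaleC_scaleC mult.commute flip: scaleC_of_real)

lemma cinner_eqI:
  fixes x :: "'a::complex_euclidean_space"
  assumes "\<And>y. cinner x y = cinner x' y"
  shows "x = x'"
proof -
  have "x \<bullet> y = x' \<bullet> y" for y using assms by (simp flip: Re_cinner)
  then show ?thesis by (metis vector_eq_rdot)
qed

lemma cinner_scaleC_left: "cinner (c *\<^sub>C x) y = cnj c * cinner x (y::'a::complex_euclidean_space)"
  by (metis cinner_commute cinner_scaleC_right complex_cnj_mult)

lemma cinner_add_left:
  "cinner (x + y) z = cinner x z + cinner y (z::'a::complex_euclidean_space)"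
  by (metis cinner_add_right cinner_commute complex_cnj_add)

lemma cinner_eq_inner:
  "cinner x y = Complex (x \<bullet> y) (- (x \<bullet> (\<i> *\<^sub>C (y::'a::complex_euclidean_space))))"
  by (simp add: complex_eq_iff cinner_scaleC_right flip: Re_cinner)

lemma norm_scaleC [simp]: "norm (c *\<^sub>C x) = cmod c * norm (x::'a::complex_euclidean_space)"
proof -
  have "(norm (c *\<^sub>C x))\<^sup>2 = Re (cnj c * c * cinner x x)"
    by (simp add: power2_norm_eq_inner cinner_scaleC_left cinner_scaleC_right mult.assoc mult.left_commute
      flip: Re_cinner)
  also have "cnj c * c = of_real ((cmod c)\<^sup>2)" by (metis complex_norm_square mult.commute)
  also have "Re (of_real ((cmod c)\<^sup>2) * cinner x x) = (cmod c)\<^sup>2 * Re (cinner x x)" by simp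
  also have "\<dots> = (cmod c * norm x)\<^sup>2"
    by (simp add: power_mult_distrib Re_cinner power2_norm_eq_inner)
  finally show ?thesis by (metis abs_norm_cancel abs_mult norm_ge_zero power2_eq_iff_nonneg mult_nonneg_nonneg)
qed

lemma blinfun_apply_smult:
  "blinfun_apply (c \<odot>\<^bsub>op_cstar\<^esub> T) x = c *\<^sub>C blinfun_apply T (x::'a::complex_euclidean_space)"
proof -
  have "bounded_linear (\<lambda>x. c *\<^sub>C blinfun_apply T x)"
  proof (rule bounded_linear_intro[where K = "cmod c * norm T"])
    fix x show "norm (c *\<^sub>C blinfun_apply T x) \<le> norm x * (cmod c * norm T)"
      using mult_left_mono[OF norm_blinfun[of T x], of "cmod c"] by (simp add: mult_ac)
  qed (simp_all add: blinfun.add_right scaleC_add_right blinfun.scaleR_right scaleC_scaleR)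
  then show ?thesis by (simp add: op_cstar_def bounded_linear_Blinfun_apply)
qed

lemma op_cstar_sel:
  "T \<in> carrier op_cstar \<longleftrightarrow> (\<forall>c x. blinfun_apply T (c *\<^sub>C x) = c *\<^sub>C blinfun_apply T x)"
  "S \<otimes>\<^bsub>op_cstar\<^esub> T = S o\<^sub>L T" "\<one>\<^bsub>op_cstar\<^esub> = id_blinfun" "\<zero>\<^bsub>op_cstar\<^esub> = 0"
  "S \<oplus>\<^bsub>op_cstar\<^esub> T = S + T" "cnorm op_cstar T = norm T"
  "star op_cstar T = (THE S. \<forall>x y. cinner (blinfun_apply S x) y = cinner x (blinfun_apply T y))"
  by (simp_all add: op_cstar_def)

lemma complex_linear_op:
  fixes f :: "'h::complex_euclidean_space \<Rightarrow> 'h"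
  assumes "\<And>x y. f (x + y) = f x + f y" "\<And>c x. f (c *\<^sub>C x) = c *\<^sub>C f x"
  shows "\<exists>T \<in> carrier op_cstar. blinfun_apply T = f"
proof -
  have "linear f" by (rule linearI) (simp_all add: assms flip: scaleC_of_real)
  then have "blinfun_apply (Blinfun f) = f"
    by (simp add: bounded_linear_Blinfun_apply linear_conv_bounded_linear)
  then show ?thesis using assms(2) by (metis op_cstar_sel(1))
qed

lemma star_op_eqI:
  fixes S T :: "'h::complex_euclidean_space \<Rightarrow>\<^sub>L 'h"
  assumes "\<And>x y. cinner (blinfun_apply S x) y = cinner x (blinfun_apply T y)"
  shows "star op_cstar T = S"
  unfolding op_cstar_sel
proof (rule the_equality)
  show "\<forall>x y. cinner (blinfun_apply S x) y = cinner x (blinfun_apply T y)" using assms by blast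
  fix R :: "'h \<Rightarrow>\<^sub>L 'h"
  assume "\<forall>x y. cinner (blinfun_apply R x) y = cinner x (blinfun_apply T y)"
  then have "blinfun_apply R x = blinfun_apply S x" for x
    using assms by (intro cinner_eqI) simp
  then show "R = S" by (rule blinfun_eqI)
qed

lemma star_op:
  fixes T :: "'h::complex_euclidean_space \<Rightarrow>\<^sub>L 'h"
  assumes T: "T \<in> carrier op_cstar"
  shows "cinner (blinfun_apply (star op_cstar T) x) y = cinner x (blinfun_apply T y)"
proof -
  have lin: "linear (blinfun_apply T)"
    by (rule bounded_linear.linear[OF blinfun.bounded_linear_right])
  define S where "S = Blinfun (adjoint (blinfun_apply T))"
  have S: "blinfun_apply S = adjoint (blinfun_apply T)"
    unfolding S_def
    by (rule bounded_linear_Blinfun_apply) (simp add: linear_conv_bounded_linear[symmetric] adjoint_linear lin)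
  have "cinner (blinfun_apply S x) y = cinner x (blinfun_apply T y)" for x y
    using T by (simp add: cinner_eq_inner S adjoint_clauses[OF lin] op_cstar_sel(1))
  then show ?thesis using star_op_eqI[of S T] by simp
qed

lemma star_op': 
  fixes T :: "'h::complex_euclidean_space \<Rightarrow>\<^sub>L 'h"
  assumes T: "T \<in> carrier op_cstar"
  shows "cinner x (blinfun_apply (star op_cstar T) y) = cinner (blinfun_apply T x) y"
  by (metis T cinner_commute star_op)

lemma star_op_mem:
  fixes T :: "'h::complex_euclidean_space \<Rightarrow>\<^sub>L 'h"
  assumes "T \<in> carrier op_cstar"
  shows "star op_cstar T \<in> carrier op_cstar"
  unfolding op_cstar_sel(1)
  using assms by (intro allI cinner_eqI) (simp add: star_op cinner_scaleC_left)

lemma op_smult_mem: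
  "T \<in> carrier op_cstar \<Longrightarrow> c \<odot>\<^bsub>op_cstar\<^esub> T \<in> carrier op_cstar"
  by (simp add: op_cstar_sel(1) blinfun_apply_smult scaleC_scaleC mult.commute)

lemma norm_op_smult: "norm (c \<odot>\<^bsub>op_cstar\<^esub> T) = cmod c * norm T"
proof (rule antisym)
  have le: "norm (c \<odot>\<^bsub>op_cstar\<^esub> T) \<le> cmod c * norm T" for c T
  proof (rule norm_blinfun_bound)
    show "norm (blinfun_apply (c \<odot>\<^bsub>op_cstar\<^esub> T) x) \<le> cmod c * norm T * norm x" for x
      using mult_left_mono[OF norm_blinfun[of T x], of "cmod c"]
      by (simp add: blinfun_apply_smult mult_ac)
  qed simp
  show "norm (c \<odot>\<^bsub>op_cstar\<^esub> T) \<le> cmod c * norm T" by (rule le)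
  show "cmod c * norm T \<le> norm (c \<odot>\<^bsub>op_cstar\<^esub> T)"
  proof (cases "c = 0")
    case False
    have "inverse c \<odot>\<^bsub>op_cstar\<^esub> (c \<odot>\<^bsub>op_cstar\<^esub> T) = T"
      by (rule blinfun_eqI) (simp add: blinfun_apply_smult scaleC_scaleC False)
    then have "norm T \<le> cmod (inverse c) * norm (c \<odot>\<^bsub>op_cstar\<^esub> T)" using le by metis
    then show ?thesis using False by (simp add: norm_inverse norm_divide field_simps)
  qed simp
qed

lemma abelian_group_op: "abelian_group (op_cstar :: ('h::complex_euclidean_space \<Rightarrow>\<^sub>L 'h) cstar)"
proof (rule abelian_groupI)
  fix T :: "'h \<Rightarrow>\<^sub>L 'h" assume T: "T \<in> carrier op_cstar"
  then have "(-1) \<odot>\<^bsub>op_cstar\<^esub> T \<in> carrier op_cstar" by (rule op_smult_mem)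
  moreover have "(-1) \<odot>\<^bsub>op_cstar\<^esub> T = - T"
    using scaleC_of_real[of "-1"]
    by (intro blinfun_eqI) (simp add: blinfun_apply_smult blinfun.minus_left)
  ultimately have "- T \<in> carrier op_cstar" by simp
  then show "\<exists>S\<in>carrier op_cstar. S \<oplus>\<^bsub>op_cstar\<^esub> T = \<zero>\<^bsub>op_cstar\<^esub>"
    by (intro bexI[of _ "- T"]) (simp_all add: op_cstar_sel(4,5))
next
  show "\<zero>\<^bsub>op_cstar\<^esub> \<in> carrier (op_cstar :: ('h \<Rightarrow>\<^sub>L 'h) cstar)"
    using scaleC_scaleR[where ?'a = 'h and r = 0 and x = 0] by (simp add: op_cstar_sel)
qed (simp_all add: op_cstar_sel blinfun.add_left scaleC_add_right)

lemma ring_op: "ring (op_cstar :: ('h::complex_euclidean_space \<Rightarrow>\<^sub>L 'h) cstar)"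
proof (rule ringI[OF abelian_group_op])
  show "Group.monoid (op_cstar :: ('h \<Rightarrow>\<^sub>L 'h) cstar)"
    by (rule monoidI) (auto simp: op_cstar_sel intro: blinfun_eqI)
qed (auto simp: op_cstar_sel(2,5) blinfun.add_left blinfun.add_right intro!: blinfun_eqI)

lemma op_minus:
  fixes S T :: "'h::complex_euclidean_space \<Rightarrow>\<^sub>L 'h"
  assumes T: "T \<in> carrier op_cstar"
  shows "S \<ominus>\<^bsub>op_cstar\<^esub> T = S - T"
proof -
  interpret ring "op_cstar :: ('h \<Rightarrow>\<^sub>L 'h) cstar" by (rule ring_op)
  have "\<ominus>\<^bsub>op_cstar\<^esub> T \<oplus>\<^bsub>op_cstar\<^esub> T = \<zero>\<^bsub>op_cstar\<^esub>" by (rule l_neg[OF T])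
  then have "\<ominus>\<^bsub>op_cstar\<^esub> T = - T" by (simp add: op_cstar_sel(4,5) eq_neg_iff_add_eq_0)
  then show ?thesis by (simp add: a_minus_def op_cstar_sel(5))
qed

lemma norm_star_op_le:
  fixes T :: "'h::complex_euclidean_space \<Rightarrow>\<^sub>L 'h"
  assumes T: "T \<in> carrier op_cstar"
  shows "(norm T)\<^sup>2 \<le> norm (star op_cstar T o\<^sub>L T)"
proof -
  have "norm (blinfun_apply T x) \<le> sqrt (norm (star op_cstar T o\<^sub>L T)) * norm x" for x
  proof -
    have "(norm (blinfun_apply T x))\<^sup>2 = x \<bullet> blinfun_apply (star op_cstar T o\<^sub>L T) x"
      using star_op'[OF T, of x "blinfun_apply T x"]
      by (simp add: power2_norm_eq_inner flip: Re_cinner)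
    also have "\<dots> \<le> norm x * norm (blinfun_apply (star op_cstar T o\<^sub>L T) x)"
      by (rule norm_cauchy_schwarz)
    also have "\<dots> \<le> norm x * (norm (star op_cstar T o\<^sub>L T) * norm x)"
      by (intro mult_left_mono norm_blinfun) auto
    also have "\<dots> = (sqrt (norm (star op_cstar T o\<^sub>L T)) * norm x)\<^sup>2"
      by (simp add: power_mult_distrib power2_eq_square)
    finally show ?thesis by (rule power2_le_imp_le) simp
  qed
  then have "norm T \<le> sqrt (norm (star op_cstar T o\<^sub>L T))" by (intro norm_blinfun_bound) auto
  then show ?thesis by (metis norm_ge_zero real_sqrt_pow2_iff power_mono)
qed

theorem unital_cstar_algebra_op:
  "unital_cstar_algebra (op_cstar :: ('h::complex_euclidean_space \<Rightarrow>\<^sub>L 'h) cstar)" (is "unital_cstar_algebra ?L")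
proof (rule unital_cstar_algebra.intro)
  show "module complex_ring ?L"
    by (rule moduleI[OF cring_complex_ring abelian_group_op])
      (auto simp: op_smult_mem complex_ring_def op_cstar_sel(5) blinfun_apply_smult blinfun.add_left
        scaleC_add_left scaleC_add_right scaleC_scaleC intro!: blinfun_eqI)
  show "ring ?L" by (rule ring_op)
  fix S T :: "'h \<Rightarrow>\<^sub>L 'h" and c
  assume T: "T \<in> carrier ?L"
  show sT: "star ?L T \<in> carrier ?L" by (rule star_op_mem[OF T])
  show ss: "star ?L (star ?L T) = T" by (rule star_op_eqI) (simp add: star_op'[OF T])
  show "star ?L (c \<odot>\<^bsub>?L\<^esub> T) = cnj c \<odot>\<^bsub>?L\<^esub> star ?L T"
    by (rule star_op_eqI)
      (simp add: star_op[OF T] blinfun_apply_smult cinner_scaleC_left cinner_scaleC_right)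
  show "cnorm ?L T = 0 \<longleftrightarrow> T = \<zero>\<^bsub>?L\<^esub>" by (simp add: op_cstar_sel)
  show "cnorm ?L (c \<odot>\<^bsub>?L\<^esub> T) = cmod c * cnorm ?L T"
    by (simp add: op_cstar_sel(6) norm_op_smult)
  have le: "norm R \<le> norm (star ?L R)" if R: "R \<in> carrier ?L" for R
  proof (cases "norm R = 0")
    case False
    have "(norm R)\<^sup>2 \<le> norm (star ?L R) * norm R"
      using norm_star_op_le[OF R] norm_blinfun_compose[of "star ?L R" R] by linarith
    then show ?thesis using False by (simp add: power2_eq_square)
  qed simp
  have "norm (star ?L T) = norm T" using le[OF T] le[OF sT] ss by simp
  then show "cnorm ?L (star ?L T \<otimes>\<^bsub>?L\<^esub> T) = (cnorm ?L T)\<^sup>2"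
    using norm_star_op_le[OF T] norm_blinfun_compose[of "star ?L T" T]
    by (simp add: op_cstar_sel(2,6) power2_eq_square)
  assume S: "S \<in> carrier ?L"
  show "(c \<odot>\<^bsub>?L\<^esub> S) \<otimes>\<^bsub>?L\<^esub> T = c \<odot>\<^bsub>?L\<^esub> (S \<otimes>\<^bsub>?L\<^esub> T)"
    by (rule blinfun_eqI) (simp add: op_cstar_sel(2) blinfun_apply_smult)
  show "S \<otimes>\<^bsub>?L\<^esub> (c \<odot>\<^bsub>?L\<^esub> T) = c \<odot>\<^bsub>?L\<^esub> (S \<otimes>\<^bsub>?L\<^esub> T)"
    using S by (intro blinfun_eqI) (simp add: op_cstar_sel(1,2) blinfun_apply_smult)
  show "star ?L (S \<oplus>\<^bsub>?L\<^esub> T) = star ?L S \<oplus>\<^bsub>?L\<^esub> star ?L T"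
    by (rule star_op_eqI)
      (simp add: op_cstar_sel(5) blinfun.add_left cinner_add_left cinner_add_right star_op S T)
  show "star ?L (S \<otimes>\<^bsub>?L\<^esub> T) = star ?L T \<otimes>\<^bsub>?L\<^esub> star ?L S"
    by (rule star_op_eqI) (simp add: op_cstar_sel(2) star_op S T)
  show "cnorm ?L (S \<oplus>\<^bsub>?L\<^esub> T) \<le> cnorm ?L S + cnorm ?L T"
    by (simp add: op_cstar_sel(5,6) norm_triangle_ineq)
  show "cnorm ?L (S \<otimes>\<^bsub>?L\<^esub> T) \<le> cnorm ?L S * cnorm ?L T"
    by (simp add: op_cstar_sel(2,6) norm_blinfun_compose)
next
  fix s :: "nat \<Rightarrow> 'h \<Rightarrow>\<^sub>L 'h"
  assume s: "\<And>n. s n \<in> carrier ?L"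
    and "\<And>e. e > 0 \<Longrightarrow> \<exists>N. \<forall>m\<ge>N. \<forall>n\<ge>N. cnorm ?L (s m \<ominus>\<^bsub>?L\<^esub> s n) < e"
  then have "Cauchy s" by (intro CauchyI) (simp add: op_minus op_cstar_sel(6))
  then obtain l where l: "s \<longlonglongrightarrow> l" using Cauchy_convergent convergent_def by blast
  have "blinfun_apply l (c *\<^sub>C x) = c *\<^sub>C blinfun_apply l x" for c x
  proof (rule LIMSEQ_unique)
    show "(\<lambda>n. blinfun_apply (s n) (c *\<^sub>C x)) \<longlonglongrightarrow> blinfun_apply l (c *\<^sub>C x)"
      by (intro tendsto_intros l)
    have "bounded_linear (\<lambda>x. c *\<^sub>C (x::'h))"
      by (rule bounded_linear_intro[where K = "cmod c"])
        (simp_all add: scaleC_add_right scaleC_scaleR)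
    then have "(\<lambda>n. c *\<^sub>C blinfun_apply (s n) x) \<longlonglongrightarrow> c *\<^sub>C blinfun_apply l x"
      by (rule bounded_linear.tendsto) (intro tendsto_intros l)
    then show "(\<lambda>n. blinfun_apply (s n) (c *\<^sub>C x)) \<longlonglongrightarrow> c *\<^sub>C blinfun_apply l x"
      using s by (simp add: op_cstar_sel(1))
  qed
  then have lc: "l \<in> carrier ?L" by (simp add: op_cstar_sel(1))
  have "(\<lambda>n. norm (s n - l)) \<longlonglongrightarrow> 0" by (intro tendsto_norm_zero LIM_zero l)
  then show "\<exists>l\<in>carrier ?L. (\<lambda>n. cnorm ?L (s n \<ominus>\<^bsub>?L\<^esub> l)) \<longlonglongrightarrow> 0"
    using lc by (intro bexI[of _ l]) (simp_all add: op_minus op_cstar_sel(6))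
qed


subsection \<open>Standard models\<close>

text \<open>\<open>\<complex>\<close> and \<open>\<complex>\<^sup>n\<close> with their usual inner products; the latter has every finite nonzero dimension.\<close>

instantiation complex :: complex_euclidean_space
begin

definition scaleC_complex :: "complex \<Rightarrow> complex \<Rightarrow> complex" where "scaleC_complex = (*)"
definition cinner_complex :: "complex \<Rightarrow> complex \<Rightarrow> complex" where "cinner_complex x y = cnj x * y"

instance
  by standard (simp_all add: scaleC_complex_def cinner_complex_def algebra_simps inner_complex_def
      scaleR_conv_of_real)

end

instantiation vec :: (complex_euclidean_space, finite) complex_euclidean_space
begin

definition scaleC_vec :: "complex \<Rightarrow> 'a ^ 'b \<Rightarrow> 'a ^ 'b" where "scaleC_vec c x = (\<chi> i. c *\<^sub>C x $ i)"
definition cinner_vec :: "'a ^ 'b \<Rightarrow> 'a ^ 'b \<Rightarrow> complex" where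
  "cinner_vec x y = (\<Sum>i\<in>UNIV. cinner (x $ i) (y $ i))"

instance
proof
  fix x y :: "'a ^ 'b"
  show "cinner x y = cnj (cinner y x)"
    unfolding cinner_vec_def cnj_sum by (intro sum.cong refl cinner_commute)
qed (simp_all add: scaleC_vec_def cinner_vec_def vec_eq_iff scaleC_add_right scaleC_add_left
      scaleC_scaleC scaleC_of_real cinner_add_right cinner_scaleC_right sum.distrib sum_distrib_left
      Re_cinner inner_vec_def)

end

lemma topspace_circle: "topspace circle = sphere 0 1" "compact_space circle" "Hausdorff_space circle"
  by (simp_all add: circle_def compact_space_subtopology Hausdorff_space_subtopology)

lemma topspace_disk: "topspace disk = cball 0 1" "compact_space disk" "Hausdorff_space disk"
  by (simp_all add: disk_def compact_space_subtopology Hausdorff_space_subtopology)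

lemma circle_into_disk: "continuous_map circle disk (\<lambda>x. x)"
  by (auto simp: circle_def disk_def)

lemma loop_identity: "loop circle (\<lambda>z. z)"
  using continuous_map_id[of circle] by (simp add: loop_def topspace_circle id_def)


end

theory Submission
  imports Defs "Jordan_Normal_Form.Determinant"
begin

text \<open>
  A null homotopy \<open>\<phi>\<close> of the identity loop sends the generator \<open>z\<close> of \<open>C(S\<^sup>1)\<close> to a continuous family
  of invertible operators on the disk that is \<open>z \<cdot> 1\<close> on the circle. Its determinant is then a
  nonvanishing continuous function on the disk that restricts to \<open>z\<^sup>n\<close> on the circle, where \<open>n > 0\<close>
  is the dimension of the Hilbert space. Such a function has a continuous logarithm, although \<open>z\<^sup>n\<close>
  has none on the circle.
\<close>

section \<open>Continuous logarithms and powers on the circle\<close>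

lemma no_continuous_nonzero_extension_power:
  fixes g :: "complex \<Rightarrow> complex"
  assumes cont: "continuous_on (cball 0 1) g"
    and nz: "\<And>z. z \<in> cball 0 1 \<Longrightarrow> g z \<noteq> 0"
    and circ: "\<And>z. z \<in> sphere 0 1 \<Longrightarrow> g z = z ^ n"
  shows "n = 0"
proof -
  obtain h where h: "continuous_on (cball 0 1) h" "\<And>z. z \<in> cball 0 1 \<Longrightarrow> g z = exp (h z)"
    using continuous_logarithm_on_cball[OF cont nz] by metis
  \<comment> \<open>Along \<open>cis t\<close>, both \<open>h (cis t)\<close> and
    \<open>\<i> n t\<close> are logarithms of \<open>z ^ n\<close>, so their difference
    \<open>k\<close> takes values in the integer multiples of \<open>2 \<pi> \<i>\<close>.\<close>
  define k where "k t = h (cis t) - \<i> * (of_nat n * of_real t)" for t :: real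
  have exp_k: "exp (k t) = 1" for t
  proof -
    have "exp (h (cis t)) = cis t ^ n" using h(2)[of "cis t"] circ[of "cis t"] by simp
    also have "\<dots> = exp (\<i> * (of_nat n * of_real t))" by (simp add: cis_conv_exp mult.left_commute flip: exp_of_nat_mult)
    finally show ?thesis by (simp add: k_def exp_diff)
  qed
  have "k constant_on UNIV"
  proof (rule continuous_discrete_range_constant)
    have "continuous_on UNIV (\<lambda>t. h (cis t))"
      by (rule continuous_on_compose2[OF h(1)]) (auto intro!: continuous_intros)
    then show "continuous_on UNIV k" unfolding k_def by (intro continuous_intros)
    \<comment> \<open>The values of \<open>k\<close> are discrete: two numbers with the same
      exponential and imaginary parts less than \<open>2 \<pi>\<close> apart are equal.\<close>
    have "2 * pi \<le> norm (k t - k s)" if "k t \<noteq> k s" for s t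
    proof (rule ccontr)
      assume "\<not> 2 * pi \<le> norm (k t - k s)"
      then have "\<bar>Im (k t) - Im (k s)\<bar> < 2 * pi" using abs_Im_le_cmod[of "k t - k s"] by simp
      then have "k t = k s" by (rule exp_complex_eqI) (simp add: exp_k)
      then show False using that by simp
    qed
    then show "\<exists>e>0. \<forall>t. t \<in> UNIV \<and> k t \<noteq> k s \<longrightarrow> e \<le> norm (k t - k s)" for s
      by (intro exI[of _ "2 * pi"]) auto
  qed simp
  \<comment> \<open>After one full turn \<open>h (cis t)\<close> returns to its value while
    \<open>\<i> n t\<close> has grown by \<open>2 \<pi> \<i> n\<close>.\<close>
  then have "k (2 * pi) = k 0" by (auto simp: constant_on_def)
  then show ?thesis by (simp add: k_def)
qed

section \<open>Hermitian inner products and orthonormal bases\<close>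

lemma additive_cinner: "Modules.additive (cinner (x :: 'h::complex_euclidean_space))"
  by standard (rule cinner_add_right)

lemmas cinner_sum_right = Modules.additive.sum[OF additive_cinner]
  and cinner_diff_right = Modules.additive.diff[OF additive_cinner]

lemma cinner_self: "cinner x x = of_real ((norm (x :: 'h::complex_euclidean_space))\<^sup>2)"
proof (rule complex_eqI)
  have "Im (cinner x x) = - Im (cinner x x)" using arg_cong[OF cinner_commute[of x x], of Im] by simp
  then show "Im (cinner x x) = Im (of_real ((norm x)\<^sup>2))" by simp
qed (simp add: Re_cinner power2_norm_eq_inner)

lemma bounded_linear_cinner_right:
  "bounded_linear (cinner (x :: 'h::complex_euclidean_space))"
proof -
  have "linear (cinner x)"
    by (rule linearI)
      (simp_all add: cinner_add_right cinner_scaleC_right scaleR_conv_of_real flip: scaleC_of_real)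
  then show ?thesis by (simp add: linear_conv_bounded_linear)
qed

text \<open>The family is indexed by numbers so that its indices can serve as matrix indices; its
  values from \<open>n\<close> on are arbitrary.\<close>

definition corthonormal :: "nat \<Rightarrow> (nat \<Rightarrow> 'h::complex_euclidean_space) \<Rightarrow> bool" where
  "corthonormal n b \<longleftrightarrow> (\<forall>i<n. \<forall>j<n. cinner (b i) (b j) = of_bool (i = j))"

lemma corthonormalD:
  "\<lbrakk>corthonormal n b; i < n; j < n\<rbrakk> \<Longrightarrow> cinner (b i) (b j) = of_bool (i = j)"
  by (simp add: corthonormal_def)

text \<open>Taking real parts makes the family orthonormal, hence independent, over the reals. The
  bound is the real dimension; it serves to show that a longest orthonormal family exists.\<close>

lemma corthonormal_le_DIM:
  fixes b :: "nat \<Rightarrow> 'h::complex_euclidean_space"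
  assumes b: "corthonormal n b"
  shows "n \<le> DIM('h)"
proof -
  have b': "b i \<bullet> b j = of_bool (i = j)" if "i < n" "j < n" for i j
    using corthonormalD[OF b that] by (simp flip: Re_cinner)
  have inj: "inj_on b {..<n}"
    by (rule inj_onI) (metis b' lessThan_iff of_bool_eq_1_iff)
  have "independent (b ` {..<n})"
  proof (rule pairwise_orthogonal_independent)
    show "pairwise real_inner_class.orthogonal (b ` {..<n})"
      by (auto simp: pairwise_def real_inner_class.orthogonal_def b')
    show "0 \<notin> b ` {..<n}" using b' by force
  qed
  then show ?thesis using independent_bound card_image[OF inj] by fastforce
qed

text \<open>An orthonormal family of greatest length is a basis: if some vector differed from its
  expansion, the normalised remainder would extend the family.\<close>

lemma ex_corthonormal_basis:
  obtains n and b :: "nat \<Rightarrow> 'h::complex_euclidean_space"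
  where "n > 0" "corthonormal n b" "\<And>x. x = (\<Sum>i<n. cinner (b i) x *\<^sub>C b i)"
proof -
  define P where "P n \<longleftrightarrow> (\<exists>b :: nat \<Rightarrow> 'h. corthonormal n b)" for n
  have "P 0" by (simp add: P_def corthonormal_def)
  moreover have bound: "n \<le> DIM('h)" if "P n" for n
    using that corthonormal_le_DIM by (auto simp: P_def)
  ultimately have greatest: "P (Greatest P)" "\<And>m. P m \<Longrightarrow> m \<le> Greatest P"
    using GreatestI_nat[of P 0 "DIM('h)"] Greatest_le_nat[of P _ "DIM('h)"] by auto
  define n where "n = Greatest P"
  obtain b :: "nat \<Rightarrow> 'h" where b: "corthonormal n b" using greatest(1) by (auto simp: P_def n_def)
  have expansion: "x = (\<Sum>i<n. cinner (b i) x *\<^sub>C b i)" for x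
  proof (rule ccontr)
    define r where "r = x - (\<Sum>i<n. cinner (b i) x *\<^sub>C b i)"
    assume "x \<noteq> (\<Sum>i<n. cinner (b i) x *\<^sub>C b i)"
    then have "norm r > 0" by (simp add: r_def)
    define u where "u = of_real (inverse (norm r)) *\<^sub>C r"
    have "cinner (b i) r = 0" if i: "i < n" for i
    proof -
      have "(\<Sum>j<n. cinner (b j) x * cinner (b i) (b j)) = (\<Sum>j<n. if j = i then cinner (b i) x else 0)"
        using corthonormalD[OF b i] by (intro sum.cong) auto
      then show ?thesis
        using i by (simp add: r_def cinner_diff_right cinner_sum_right cinner_scaleC_right)
    qed
    then have r: "cinner (b i) u = 0" "cinner u (b i) = 0" if "i < n" for i
      using that cinner_commute[of u "b i"] by (simp_all add: u_def cinner_scaleC_right)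
    have "cinner u u = 1"
      using \<open>norm r > 0\<close> by (simp add: cinner_self u_def norm_inverse)
    then have "corthonormal (Suc n) (b(n := u))"
      using b r by (auto simp: corthonormal_def less_Suc_eq)
    then have "Suc n \<le> n" unfolding n_def by (intro greatest(2)) (auto simp: P_def)
    then show False by simp
  qed
  \<comment> \<open>An empty basis would make every vector zero, but a Euclidean space has a nonzero
    basis vector.\<close>
  have "n > 0"
  proof (rule ccontr)
    assume "\<not> n > 0"
    then have "x = 0" for x :: 'h using expansion[of x] by simp
    then show False using nonzero_Basis SOME_Basis by blast
  qed
  then show thesis using that b expansion by blast
qed

section \<open>Matrices and determinants of operators\<close>

lemma blinfun_apply_sum_scaleC:
  assumes "T \<in> carrier op_cstar"
  shows "blinfun_apply T (\<Sum>i\<in>I. c i *\<^sub>C x i) = (\<Sum>i\<in>I. c i *\<^sub>C blinfun_apply T (x i))"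
  using assms by (simp add: blinfun.sum_right op_cstar_sel(1))

text \<open>The size \<open>n\<close> is obtained from an existence statement, so the matrices used
  are those that carry their size as a value and not in their type.\<close>

definition op_mat ::
    "nat \<Rightarrow> (nat \<Rightarrow> 'h::complex_euclidean_space) \<Rightarrow> ('h \<Rightarrow>\<^sub>L 'h) \<Rightarrow> complex Matrix.mat" where
  "op_mat n b T = Matrix.mat n n (\<lambda>(i, j). cinner (b i) (blinfun_apply T (b j)))"

lemma op_mat_carrier [simp]: "op_mat n b T \<in> carrier_mat n n"
  by (simp add: op_mat_def)

text \<open>Expand \<open>T (b j)\<close> in the basis and move the sum through \<open>S\<close>,
  which is complex-linear by membership in the carrier.\<close>

lemma op_mat_compose:
  assumes b: "\<And>x. x = (\<Sum>i<n. cinner (b i) x *\<^sub>C b i)" and S: "S \<in> carrier op_cstar"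
  shows "op_mat n b (S o\<^sub>L T) = op_mat n b S * op_mat n b T"
proof (rule eq_matI)
  fix i j assume "i < dim_row (op_mat n b S * op_mat n b T)" "j < dim_col (op_mat n b S * op_mat n b T)"
  then have ij: "i < n" "j < n" by (simp_all add: op_mat_def)
  have "cinner (b i) (S (T (b j))) = cinner (b i) (S (\<Sum>k<n. cinner (b k) (T (b j)) *\<^sub>C b k))"
    using arg_cong[OF b[of "T (b j)"], of "\<lambda>x. cinner (b i) (S x)"] .
  also have "\<dots> = (\<Sum>k<n. cinner (b i) (S (b k)) * cinner (b k) (T (b j)))"
    by (simp add: blinfun_apply_sum_scaleC[OF S] cinner_sum_right cinner_scaleC_right mult.commute)
  finally show "op_mat n b (S o\<^sub>L T) $$ (i, j) = (op_mat n b S * op_mat n b T) $$ (i, j)"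
    using ij by (simp add: op_mat_def scalar_prod_def atLeast0LessThan)
qed (simp_all add: op_mat_def)

lemma op_mat_smult_id:
  assumes "corthonormal n b"
  shows "op_mat n b (c \<odot>\<^bsub>op_cstar\<^esub> id_blinfun) = c \<cdot>\<^sub>m 1\<^sub>m n"
  using corthonormalD[OF assms]
  by (intro eq_matI) (auto simp: op_mat_def blinfun_apply_smult cinner_scaleC_right)

text \<open>By the Leibniz formula the determinant is a polynomial in the entries, and each entry
  depends continuously on the operator in the operator norm.\<close>

lemma continuous_on_det_op_mat:
  fixes F :: "'x::topological_space \<Rightarrow> 'h::complex_euclidean_space \<Rightarrow>\<^sub>L 'h"
  assumes F: "continuous_on X F"
  shows "continuous_on X (\<lambda>x. Determinant.det (op_mat n b (F x)))"
proof -
  have entry: "continuous_on X (\<lambda>x. cinner u (blinfun_apply (F x) v))" for u v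
    by (intro bounded_linear.continuous_on[OF bounded_linear_cinner_right] continuous_intros F)
  \<comment> \<open>A permutation keeps \<open>p i\<close> below \<open>n\<close>, so the index is
    within the matrix.\<close>
  have "op_mat n b (F x) $$ (i, p i) = cinner (b i) (F x (b (p i)))"
    if "i \<in> {0..<n}" "p permutes {0..<n}" for x i p
    using that permutes_in_image[OF that(2), of i] by (simp add: op_mat_def)
  then have "Determinant.det (op_mat n b (F x)) =
      (\<Sum>p | p permutes {0..<n}. signof p * (\<Prod>i = 0..<n. cinner (b i) (F x (b (p i)))))" for x
    unfolding det_def'[OF op_mat_carrier] by (intro sum.cong prod.cong arg_cong2[of _ _ _ _ "(*)"]) auto
  then show ?thesis by (simp only:) (intro continuous_intros entry)
qed

section \<open>Norm continuity of elements of the tensor product\<close>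

text \<open>Finite sums of functions \<open>x \<mapsto> a(x)b\<close> are norm continuous, and
  elements of the tensor product are uniform limits of such sums.\<close>

lemma continuous_map_cont_tensor:
  fixes F :: "'x \<Rightarrow> 'h::complex_euclidean_space \<Rightarrow>\<^sub>L 'h"
  assumes X: "compact_space X" "topspace X \<noteq> {}"
    and F: "F \<in> carrier (cont_tensor X op_cstar)"
  shows "continuous_map X euclidean F"
proof -
  interpret L: unital_cstar_algebra "op_cstar :: ('h \<Rightarrow>\<^sub>L 'h) cstar"
    by (rule unital_cstar_algebra_op)
  let ?W = "tensor_span (cont_cstar X) (op_cstar :: ('h \<Rightarrow>\<^sub>L 'h) cstar)
    (fun_cstar X op_cstar) (elem_tensor X op_cstar)"
  have W: "continuous_map X euclidean G" if "G \<in> ?W" for G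
    using that
  proof induction
    case zero
    show ?case by (rule continuous_map_eq[of _ _ "\<lambda>_. 0"]) (auto simp: fun_cstar_sel op_cstar_sel)
  next
    case (add p a b)
    \<comment> \<open>Composing this map with \<open>a\<close> makes the elementary tensor of
      \<open>a\<close> and \<open>b\<close> continuous.\<close>
    have "bounded_linear (\<lambda>c. c \<odot>\<^bsub>op_cstar\<^esub> b)"
      by (rule bounded_linear_intro[where K = "norm b"])
        (auto simp: norm_op_smult blinfun_apply_smult scaleC_add_left blinfun.add_left
          blinfun.scaleR_left scaleR_conv_of_real scaleC_scaleC
          simp flip: scaleC_of_real intro!: blinfun_eqI)
    from bounded_linear.tendsto[OF this] add(2)
    have "continuous_map X euclidean (\<lambda>x. a x \<odot>\<^bsub>op_cstar\<^esub> b)"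
      by (auto simp: cont_cstar_sel continuous_map_atin)
    with add(4) have "continuous_map X euclidean (\<lambda>x. p x + a x \<odot>\<^bsub>op_cstar\<^esub> b)"
      by (rule continuous_map_add)
    then show ?case
      by (rule continuous_map_eq) (auto simp: fun_cstar_sel op_cstar_sel elem_tensor_def)
  qed
  have "\<exists>G. continuous_map X euclidean G \<and> (\<forall>x\<in>topspace X. dist (G x) (F x) < e)" if "e > 0" for e
  proof -
    from L.S_app[OF X F that] obtain G where G: "G \<in> ?W"
      "\<And>x. x \<in> topspace X \<Longrightarrow> norm (F x \<ominus>\<^bsub>op_cstar\<^esub> G x) < e"
      by (auto simp: op_cstar_sel(6))
    have "dist (G x) (F x) < e" if "x \<in> topspace X" for x
      using G(2)[OF that] op_minus[OF L.W_mem'[OF X G(1) that], of "F x"]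
      by (simp add: dist_norm norm_minus_commute)
    then show ?thesis using W[OF G(1)] by blast
  qed
  then obtain G where G: "\<And>e. e > 0 \<Longrightarrow> continuous_map X euclidean (G e)"
    "\<And>e x. e > 0 \<Longrightarrow> x \<in> topspace X \<Longrightarrow> dist (G e x) (F x) < e" by metis
  have "continuous_map X Met_TC.mtopology F"
  \<comment> \<open>The approximants are indexed by their error \<open>e\<close>, and the limit is
    taken as \<open>e\<close> decreases to 0.\<close>
  proof (rule Met_TC.continuous_map_uniform_limit[where F = "at_right 0" and f = G])
    show "\<forall>\<^sub>F e in at_right 0. continuous_map X Met_TC.mtopology (G e)"
      using G(1) by (auto simp: eventually_at_right_field mtopology_is_euclidean intro: exI[of _ 1])
    show "\<forall>\<^sub>F e in at_right 0. \<forall>x\<in>topspace X. F x \<in> UNIV \<and> dist (G e x) (F x) < \<epsilon>" if "0 < \<epsilon>" for \<epsilon>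
      unfolding eventually_at_right_field
      by (rule exI[of _ \<epsilon>]) (use that G(2) in \<open>force intro: less_trans\<close>)
  qed auto
  then show ?thesis by (simp add: mtopology_is_euclidean)
qed

section \<open>The determinant of the image of the coordinate function\<close>

theorem proposition2p4:
  shows "\<not> quantum_nullhomotopic TYPE('h::complex_euclidean_space) circle (\<lambda>z. z)"
proof
  let ?L = "op_cstar :: ('h \<Rightarrow>\<^sub>L 'h) cstar"
  interpret L: unital_cstar_algebra ?L by (rule unital_cstar_algebra_op)
  have disk: "compact_space disk" "topspace disk \<noteq> {}" by (simp_all add: topspace_disk)
  assume "quantum_nullhomotopic TYPE('h) circle (\<lambda>z. z)"
  then obtain \<phi> where \<phi>: "\<phi> \<in> unital_star_hom (cont_cstar circle) (cont_tensor disk ?L)"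
    and circ: "\<And>a. a \<in> carrier (cont_cstar circle) \<Longrightarrow>
      pullback_tensor circle (\<lambda>x. x) (\<phi> a) =
      elem_tensor circle op_cstar (pullback circle (\<lambda>z. z) a) \<one>\<^bsub>?L\<^esub>"
    by (auto simp: quantum_nullhomotopic_def)
  have hom: "\<phi> \<in> Ring.ring_hom (cont_cstar circle) (cont_tensor disk ?L)"
    using \<phi> by (simp add: unital_star_hom_def)
  \<comment> \<open>The coordinate function; its conjugate \<open>\<zeta>'\<close> is its inverse on
    the circle, so \<open>\<phi> \<zeta>\<close> is invertible at every point of the disk.\<close>
  define \<zeta> where "\<zeta> = (\<lambda>z\<in>topspace circle. z)"
  define \<zeta>' where "\<zeta>' = (\<lambda>z\<in>topspace circle. cnj z)"
  have "restrict f (topspace circle) \<in> carrier (cont_cstar circle)"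
    if "continuous_on (sphere 0 1) f" for f
  proof -
    have "continuous_map circle euclidean (restrict f (topspace circle))"
      by (rule continuous_map_eq[of _ _ f]) (use that in \<open>auto simp: circle_def\<close>)
    then show ?thesis by (simp add: cont_cstar_sel)
  qed
  then have \<zeta>: "\<zeta> \<in> carrier (cont_cstar circle)" "\<zeta>' \<in> carrier (cont_cstar circle)"
    unfolding \<zeta>_def \<zeta>'_def by (blast intro: continuous_on_id continuous_on_cnj)+
  have "\<zeta> \<otimes>\<^bsub>cont_cstar circle\<^esub> \<zeta>' = \<one>\<^bsub>cont_cstar circle\<^esub>"
    by (auto simp: cont_cstar_sel \<zeta>_def \<zeta>'_def topspace_circle complex_norm_square[symmetric])
  then have prod: "\<phi> \<zeta> \<otimes>\<^bsub>cont_tensor disk ?L\<^esub> \<phi> \<zeta>' = \<one>\<^bsub>cont_tensor disk ?L\<^esub>"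
    using ring_hom_mult[OF hom \<zeta>] ring_hom_one[OF hom] by simp
  have inverse: "\<phi> \<zeta> z o\<^sub>L \<phi> \<zeta>' z = id_blinfun" if "z \<in> cball 0 1" for z
    using fun_cong[OF prod, of z] that by (simp add: cont_tensor_sel op_cstar_sel topspace_disk)
  have mem: "\<phi> \<zeta> \<in> carrier (cont_tensor disk ?L)" by (rule ring_hom_closed[OF hom \<zeta>(1)])
  have cont: "continuous_on (cball 0 1) (\<phi> \<zeta>)"
    using continuous_map_cont_tensor[OF disk mem] by (simp add: disk_def)
  have boundary: "\<phi> \<zeta> z = z \<odot>\<^bsub>op_cstar\<^esub> id_blinfun" if "z \<in> sphere 0 1" for z
    using fun_cong[OF circ[OF \<zeta>(1)], of z] that
    by (simp add: pullback_tensor_def elem_tensor_def pullback_def topspace_circle \<zeta>_def op_cstar_sel)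
  obtain n and b :: "nat \<Rightarrow> 'h" where b: "n > 0" "corthonormal n b"
    "\<And>x. x = (\<Sum>i<n. cinner (b i) x *\<^sub>C b i)"
    by (rule ex_corthonormal_basis) (rule that)
  have id: "op_mat n b id_blinfun = 1\<^sub>m n"
    using corthonormalD[OF b(2)] by (intro eq_matI) (auto simp: op_mat_def)
  have "n = 0"
  proof (rule no_continuous_nonzero_extension_power)
    show "continuous_on (cball 0 1) (\<lambda>z. Determinant.det (op_mat n b (\<phi> \<zeta> z)))"
      by (rule continuous_on_det_op_mat[OF cont])
    \<comment> \<open>The determinants of \<open>\<phi> \<zeta> z\<close> and of its right inverse
      \<open>\<phi> \<zeta>' z\<close> have product 1.\<close>
    show "Determinant.det (op_mat n b (\<phi> \<zeta> z)) \<noteq> 0" if z: "z \<in> cball 0 1" for z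
    proof -
      have "\<phi> \<zeta> z \<in> carrier ?L" using L.S_mem[OF disk mem] z by (simp add: topspace_disk)
      then have "op_mat n b (\<phi> \<zeta> z) * op_mat n b (\<phi> \<zeta>' z) = 1\<^sub>m n"
        using op_mat_compose[OF b(3)] inverse[OF z] id by metis
      then have "Determinant.det (op_mat n b (\<phi> \<zeta> z)) * Determinant.det (op_mat n b (\<phi> \<zeta>' z)) = 1"
        using det_mult[of "op_mat n b (\<phi> \<zeta> z)" n "op_mat n b (\<phi> \<zeta>' z)"] by simp
      then show ?thesis by auto
    qed
    \<comment> \<open>On the circle the matrix is \<open>z\<close> times the identity of size
      \<open>n\<close>.\<close>
    show "Determinant.det (op_mat n b (\<phi> \<zeta> z)) = z ^ n" if "z \<in> sphere 0 1" for z
      by (simp add: boundary[OF that] op_mat_smult_id[OF b(2)])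
  qed
  then show False using b(1) by simp
qed

end
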